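(* Let $\lambda\in(0,1)$, let $f:\mathbb{R}\to\mathbb{R}$ be Lipschitz continuous, let $F$ be a numerical flux for $f$, and let $u_0\in L^1(\mathbb{R})\cap BV(\mathbb{R})$. Let $\tilde u$ be the piecewise constant function generated by either the implicit-explicit method or the fully explicit method, the corresponding CFL condition being satisfied. Then for all $t\ge0$: (i) $\|\tilde u(\cdot,t)\|_{L^\infty(\mathbb{R})}\le\|u_0\|_{L^\infty(\mathbb{R})}$; (ii) $\|\tilde u(\cdot,t)\|_{L^1(\mathbb{R})}\le\|u_0\|_{L^1(\mathbb{R})}$; (iii) $|\tilde u(\cdot,t)|_{BV(\mathbb{R})}\le|u_0|_{BV(\mathbb{R})}$. Moreover, there exists a constant $c>0$, independent of the discretization parameters $\Delta x,\Delta t$, such that for all $s,t\ge0$: (iv) $\|\tilde u(\cdot,s)-\tilde u(\cdot,t)\|_{L^1(\mathbb{R})}\le c\,(|s-t|+\Delta x)$.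
   Context: $|\cdot|_{BV(\mathbb{R})}$ is the total variation seminorm. Operator: $g[\varphi](x)=c_\lambda\int_{|z|>0}\frac{\varphi(x+z)-\varphi(x)}{|z|^{1+\lambda}}dz$ is the fractional Laplacian $-(-\partial_x^2)^{\lambda/2}$, $c_\lambda>0$ its normalizing constant. Numerical flux: $F:\mathbb{R}\times\mathbb{R}\to\mathbb{R}$ is Lipschitz continuous, $F(a,a)=f(a)$ for all $a$, $F$ is non-decreasing in its first variable and non-increasing in its second variable. $F_1,F_2>0$ denote Lipschitz constants of $F$ with respect to its first and second variable. Grid: $\Delta x,\Delta t>0$, $x_i=i\Delta x$, $I_i=(x_i,x_{i+1})$, $i\in\mathbb{Z}$; $t_n=n\Delta t$, $n=0,1,2,\ldots$. Put $G^i_j:=\int_{I_i}g[\mathbf{1}_{I_j}]\,dx$, $g\langle U\rangle_i:=\frac1{\Delta x}\sum_{j\in\mathbb{Z}}G^i_jU_j$, and $D_-F(U_i,U_{i+1}):=\frac1{\Delta x}\big(F(U_i,U_{i+1})-F(U_{i-1},U_i)\big)$. Both methods start from $U_i^0=\frac1{\Delta x}\int_{I_i}u_0(x)\,dx$. Implicit-explicit method: $U_i^{n+1}=U_i^n-\Delta t\,D_-F(U_i^n,U_{i+1}^n)+\Delta t\,g\langle U^{n+1}\rangle_i$, where $U^{n+1}$ is the unique solution in $\ell^\infty(\mathbb{Z})\cap\ell^1(\mathbb{Z})$. CFL condition: $(F_1+F_2)\frac{\Delta t}{\Delta x}\le1$. Fully explicit method: $U_i^{n+1}=U_i^n-\Delta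 t\,D_-F(U_i^n,U_{i+1}^n)+\Delta t\,g\langle U^n\rangle_i$. CFL condition: $(F_1+F_2)\frac{\Delta t}{\Delta x}+d_\lambda\frac{\Delta t}{\Delta x^\lambda}\le1$, with $d_\lambda:=c_\lambda\big(\int_{|z|<1}\frac{dz}{|z|^\lambda}+\int_{|z|>1}\frac{dz}{|z|^{1+\lambda}}\big)$. Interpolation: $\tilde u(x,t)=U_i^n$ for $(x,t)\in[x_i,x_{i+1})\times[t_n,t_{n+1})$. *)

theory Defs
  imports "HOL-Analysis.Analysis" "HOL-Probability.Essential_Supremum"
begin

section \<open>Norms and the total variation seminorm\<close>

text \<open>The norms take values in \<^typ>\<open>ennreal\<close>, so they are meaningful without an integrability
  hypothesis.\<close>

definition L1_norm :: "(real \<Rightarrow> real) \<Rightarrow> ennreal" where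
  "L1_norm u = (\<integral>\<^sup>+ x. ennreal \<bar>u x\<bar> \<partial>lebesgue)"

definition Linf_norm :: "(real \<Rightarrow> real) \<Rightarrow> ennreal" where
  "Linf_norm u = esssup lebesgue (\<lambda>x. ennreal \<bar>u x\<bar>)"

definition BV_test_functions :: "(real \<Rightarrow> real) set" where
  "BV_test_functions =
     {\<phi>. \<phi> C1_differentiable_on UNIV \<and> compact (closure {x. \<phi> x \<noteq> 0}) \<and> (\<forall>x. \<bar>\<phi> x\<bar> \<le> 1)}"

text \<open>Total variation of the distributional derivative. It does not change when \<open>u\<close> is modified on
  a null set, unlike the pointwise variation. Meaningful for locally integrable \<open>u\<close>.\<close>

definition BV_seminorm :: "(real \<Rightarrow> real) \<Rightarrow> ereal" where
  "BV_seminorm u = (SUP \<phi>\<in>BV_test_functions. ereal (LINT x|lebesgue. u x * deriv \<phi> x))"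


section \<open>The fractional Laplacian\<close>

text \<open>The normalization that gives the operator \<open>frac_lap\<close> below the Fourier symbol
  \<open>- \<bar>\<xi>\<bar> powr lam\<close>. The symbol is real and even, so it is the value at the origin of the operator
  applied to \<open>\<lambda>y. cos (\<xi> * y)\<close>; see \<open>frac_lap_cos\<close>.\<close>

definition c_const :: "real \<Rightarrow> real" where
  "c_const lam = 1 / (LINT z|lebesgue. (1 - cos z) / \<bar>z\<bar> powr (1 + lam))"

definition frac_lap :: "real \<Rightarrow> (real \<Rightarrow> real) \<Rightarrow> real \<Rightarrow> real" where
  "frac_lap lam \<phi> x =
     c_const lam * (LINT z:{z. \<bar>z\<bar> > 0}|lebesgue. (\<phi> (x + z) - \<phi> x) / \<bar>z\<bar> powr (1 + lam))"

definition d_const :: "real \<Rightarrow> real" where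
  "d_const lam = c_const lam *
     ((LINT z:{z. \<bar>z\<bar> < 1}|lebesgue. 1 / \<bar>z\<bar> powr lam) +
      (LINT z:{z. \<bar>z\<bar> > 1}|lebesgue. 1 / \<bar>z\<bar> powr (1 + lam)))"


section \<open>Numerical flux and grid\<close>

definition numerical_flux :: "(real \<Rightarrow> real) \<Rightarrow> (real \<Rightarrow> real \<Rightarrow> real) \<Rightarrow> bool" where
  "numerical_flux f F \<longleftrightarrow>
     (\<exists>L. L-lipschitz_on UNIV (\<lambda>(a, b). F a b)) \<and>
     (\<forall>a. F a a = f a) \<and>
     (\<forall>b. mono (\<lambda>a. F a b)) \<and>
     (\<forall>a. antimono (\<lambda>b. F a b))"

definition flux_lipschitz_constants :: "(real \<Rightarrow> real \<Rightarrow> real) \<Rightarrow> real \<Rightarrow> real \<Rightarrow> bool" where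
  "flux_lipschitz_constants F F1 F2 \<longleftrightarrow>
     0 < F1 \<and> 0 < F2 \<and>
     (\<forall>b. F1-lipschitz_on UNIV (\<lambda>a. F a b)) \<and>
     (\<forall>a. F2-lipschitz_on UNIV (\<lambda>b. F a b))"

definition cell :: "real \<Rightarrow> int \<Rightarrow> real set" where
  "cell dx i = {of_int i * dx <..< of_int (i + 1) * dx}"

definition cell_average :: "real \<Rightarrow> (real \<Rightarrow> real) \<Rightarrow> int \<Rightarrow> real" where
  "cell_average dx u i = 1 / dx * (LINT x:cell dx i|lebesgue. u x)"

definition G_weight :: "real \<Rightarrow> real \<Rightarrow> int \<Rightarrow> int \<Rightarrow> real" where
  "G_weight lam dx i j = (LINT x:cell dx i|lebesgue. frac_lap lam (indicator (cell dx j)) x)"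

definition discrete_frac_lap :: "real \<Rightarrow> real \<Rightarrow> (int \<Rightarrow> real) \<Rightarrow> int \<Rightarrow> real" where
  "discrete_frac_lap lam dx U i = 1 / dx * (\<Sum>\<^sub>\<infinity>j\<in>UNIV. G_weight lam dx i j * U j)"

definition flux_difference :: "(real \<Rightarrow> real \<Rightarrow> real) \<Rightarrow> real \<Rightarrow> (int \<Rightarrow> real) \<Rightarrow> int \<Rightarrow> real" where
  "flux_difference F dx U i = 1 / dx * (F (U i) (U (i + 1)) - F (U (i - 1)) (U i))"

definition in_linf_l1 :: "(int \<Rightarrow> real) \<Rightarrow> bool" where
  "in_linf_l1 V \<longleftrightarrow> bounded (range V) \<and> (\<lambda>i. \<bar>V i\<bar>) summable_on UNIV"


section \<open>The two methods\<close>

text \<open>\<open>U n i\<close> stands for the value $U_i^n$. The implicit step is stated as a relation: the new time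
  level is required to be a bounded and summable solution.\<close>

definition implicit_explicit_method ::
    "real \<Rightarrow> (real \<Rightarrow> real \<Rightarrow> real) \<Rightarrow> (real \<Rightarrow> real) \<Rightarrow> real \<Rightarrow> real \<Rightarrow> (nat \<Rightarrow> int \<Rightarrow> real) \<Rightarrow> bool" where
  "implicit_explicit_method lam F u0 dx dt U \<longleftrightarrow>
     U 0 = cell_average dx u0 \<and>
     (\<forall>n. in_linf_l1 (U (Suc n)) \<and>
       (\<forall>i. U (Suc n) i =
          U n i - dt * flux_difference F dx (U n) i + dt * discrete_frac_lap lam dx (U (Suc n)) i))"

definition explicit_method ::
    "real \<Rightarrow> (real \<Rightarrow> real \<Rightarrow> real) \<Rightarrow> (real \<Rightarrow> real) \<Rightarrow> real \<Rightarrow> real \<Rightarrow> (nat \<Rightarrow> int \<Rightarrow> real) \<Rightarrow> bool" where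
  "explicit_method lam F u0 dx dt U \<longleftrightarrow>
     U 0 = cell_average dx u0 \<and>
     (\<forall>n i. U (Suc n) i =
        U n i - dt * flux_difference F dx (U n) i + dt * discrete_frac_lap lam dx (U n) i)"

definition implicit_explicit_CFL :: "real \<Rightarrow> real \<Rightarrow> real \<Rightarrow> real \<Rightarrow> bool" where
  "implicit_explicit_CFL F1 F2 dx dt \<longleftrightarrow> (F1 + F2) * (dt / dx) \<le> 1"

definition explicit_CFL :: "real \<Rightarrow> real \<Rightarrow> real \<Rightarrow> real \<Rightarrow> real \<Rightarrow> bool" where
  "explicit_CFL lam F1 F2 dx dt \<longleftrightarrow>
     (F1 + F2) * (dt / dx) + d_const lam * (dt / dx powr lam) \<le> 1"

definition generated_with_CFL ::
    "real \<Rightarrow> (real \<Rightarrow> real \<Rightarrow> real) \<Rightarrow> real \<Rightarrow> real \<Rightarrow> (real \<Rightarrow> real) \<Rightarrow> real \<Rightarrow> real \<Rightarrow>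
       (nat \<Rightarrow> int \<Rightarrow> real) \<Rightarrow> bool" where
  "generated_with_CFL lam F F1 F2 u0 dx dt U \<longleftrightarrow>
     (implicit_explicit_method lam F u0 dx dt U \<and> implicit_explicit_CFL F1 F2 dx dt) \<or>
     (explicit_method lam F u0 dx dt U \<and> explicit_CFL lam F1 F2 dx dt)"

text \<open>The floors select the grid indices, see \<open>interpolation_eq\<close>. Used only for \<open>t \<ge> 0\<close>.\<close>

definition interpolation :: "real \<Rightarrow> real \<Rightarrow> (nat \<Rightarrow> int \<Rightarrow> real) \<Rightarrow> real \<Rightarrow> real \<Rightarrow> real" where
  "interpolation dx dt U x t = U (nat \<lfloor>t / dt\<rfloor>) \<lfloor>x / dx\<rfloor>"

lemma interpolation_eq:
  assumes "0 < dx" "0 < dt"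
    and x: "x \<in> {of_int i * dx ..< of_int (i + 1) * dx}"
    and t: "t \<in> {of_nat n * dt ..< of_nat (n + 1) * dt}"
  shows "interpolation dx dt U x t = U n i"
proof -
  have "\<lfloor>x / dx\<rfloor> = i"
    using x \<open>0 < dx\<close> by (intro floor_unique) (simp_all add: field_simps)
  moreover have "\<lfloor>t / dt\<rfloor> = int n"
    using t \<open>0 < dt\<close> by (intro floor_unique) (simp_all add: field_simps)
  ultimately show ?thesis
    by (simp add: interpolation_def)
qed


section \<open>The normalization of the fractional Laplacian\<close>

lemma kernel_cos_bound:
  fixes z :: real
  assumes "0 < lam" "lam < 1"
  shows "(1 - cos z) / \<bar>z\<bar> powr (1 + lam) \<le> (if \<bar>z\<bar> \<le> 1 then 1 else 2 * \<bar>z\<bar> powr (- 1 - lam))"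
proof (cases "\<bar>z\<bar> \<le> 1")
  case True
  show ?thesis
  proof (cases "z = 0")
    case False
    have "1 - cos z \<le> z^2 / 2"
    proof -
      have "\<bar>sin (z / 2)\<bar> \<le> \<bar>z / 2\<bar>" by (rule abs_sin_x_le_abs_x)
      then have "sin (z / 2) ^ 2 \<le> (z / 2) ^ 2" by (simp only: abs_le_square_iff)
      moreover have "cos z = 1 - 2 * sin (z / 2) ^ 2"
        using cos_double_sin[of "z / 2"] by simp
      ultimately show ?thesis by (simp add: power_divide)
    qed
    also have "\<dots> \<le> z^2" by simp
    also have "\<dots> = \<bar>z\<bar> powr 2" using False by simp
    also have "\<dots> \<le> \<bar>z\<bar> powr (1 + lam)"
      using True False assms by (intro powr_mono') auto
    finally show ?thesis using True False by simp
  qed simp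
next
  case False
  have "1 - cos z \<le> 2" using cos_ge_minus_one[of z] by simp
  then have "(1 - cos z) / \<bar>z\<bar> powr (1 + lam) \<le> 2 / \<bar>z\<bar> powr (1 + lam)"
    by (intro divide_right_mono) auto
  also have "\<dots> = 2 * \<bar>z\<bar> powr (- (1 + lam))" by (simp only: powr_minus divide_inverse)
  finally show ?thesis using False by simp
qed

lemma tail_integrable:
  fixes lam :: real assumes "0 < lam"
  shows "integrable lborel (\<lambda>z. indicator {1..} z * z powr (- 1 - lam))"
proof -
  have "(\<lambda>z. z powr (- 1 - lam)) integrable_on {1..}"
    using has_integral_powr_to_inf[of "- 1 - lam" 1] assms by (auto simp: integrable_on_def)
  then have "(\<lambda>z. z powr (- 1 - lam)) absolutely_integrable_on {1..}"
    by (intro nonnegative_absolutely_integrable_1) auto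
  then have "integrable lebesgue (\<lambda>z. indicator {1..} z * z powr (- 1 - lam))"
    by (simp add: set_integrable_def)
  then show ?thesis
    by (subst (asm) integrable_completion) auto
qed

lemma kernel_cos_integrable:
  fixes lam :: real
  assumes "0 < lam" "lam < 1"
  shows "integrable lborel (\<lambda>z. (1 - cos z) / \<bar>z\<bar> powr (1 + lam))"
proof (rule Bochner_Integration.integrable_bound)
  let ?t = "\<lambda>z. indicator {1..} z * z powr (- 1 - lam)"
  have "integrable lborel (\<lambda>z. ?t (0 + (-1) * z))"
    using tail_integrable[OF assms(1)] by (intro lborel_integrable_real_affine) auto
  then show "integrable lborel (\<lambda>z. indicator {-1..1} z + 2 * ?t z + 2 * ?t (0 + (-1) * z))"
    using tail_integrable[OF assms(1)] 
    by (intro Bochner_Integration.integrable_add integrable_mult_right) (auto simp: mult.commute)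
  show "AE z in lborel. norm ((1 - cos z) / \<bar>z\<bar> powr (1 + lam))
      \<le> norm (indicator {-1..1} z + 2 * ?t z + 2 * ?t (0 + (-1) * z))"
  proof (intro AE_I2)
    fix z :: real
    have nn: "0 \<le> ?t y" for y by auto
    have "norm ((1 - cos z) / \<bar>z\<bar> powr (1 + lam)) \<le> (if \<bar>z\<bar> \<le> 1 then 1 else 2 * \<bar>z\<bar> powr (- 1 - lam))"
      using kernel_cos_bound[OF assms, of z] by simp
    also have "\<dots> \<le> indicator {-1..1} z + 2 * ?t z + 2 * ?t (0 + (-1) * z)"
      using nn[of z] nn[of "-z"] by (auto simp: indicator_def)
    finally show "norm ((1 - cos z) / \<bar>z\<bar> powr (1 + lam))
      \<le> norm (indicator {-1..1} z + 2 * ?t z + 2 * ?t (0 + (-1) * z))" by simp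
  qed
qed auto

lemma c_const_lborel: "c_const lam = 1 / (LINT z|lborel. (1 - cos z) / \<bar>z\<bar> powr (1 + lam))"
  unfolding c_const_def by (subst integral_completion) auto

lemma c_const_pos:
  assumes "0 < lam" "lam < 1"
  shows "0 < c_const lam"
proof -
  let ?k = "\<lambda>z. (1 - cos z) / \<bar>z\<bar> powr (1 + lam)"
  have nn: "0 \<le> ?k z" for z by simp
  have "integral\<^sup>L lborel ?k \<noteq> 0"
  proof
    assume "integral\<^sup>L lborel ?k = 0"
    then have "AE z in lborel. ?k z = 0"
      using kernel_cos_integrable[OF assms] nn by (subst (asm) integral_nonneg_eq_0_iff_AE) auto
    moreover have "z \<notin> {0<..<1}" if "?k z = 0" for z
    proof
      assume "z \<in> {0<..<1}"
      note that this
      moreover have "cos z < cos 0" using \<open>z \<in> {0<..<1}\<close> pi_gt3 by (intro cos_monotone_0_pi) auto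
      ultimately show False by auto
    qed
    ultimately have "AE z in lborel. z \<notin> {0<..<1::real}"
      by (auto elim: eventually_mono)
    then have "emeasure lborel {0<..<1::real} = 0"
      by (subst (asm) AE_iff_measurable[OF _ refl]) (auto simp: greaterThanLessThan_def greaterThan_def lessThan_def Int_def)
    then show False by simp
  qed
  moreover have "0 \<le> integral\<^sup>L lborel ?k" by (intro integral_nonneg_AE) auto
  ultimately have "0 < integral\<^sup>L lborel ?k" by linarith
  then show ?thesis by (simp add: c_const_lborel)
qed

lemma frac_lap_cos:
  assumes lam: "0 < lam" "lam < 1"
  shows "frac_lap lam (\<lambda>y. cos (\<xi> * y)) 0 = - (\<bar>\<xi>\<bar> powr lam)"
proof (cases "\<xi> = 0")
  case False
  let ?k = "\<lambda>z. (1 - cos z) / \<bar>z\<bar> powr (1 + lam)"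
  let ?A = "\<lambda>z. (1 - cos (\<xi> * z)) / \<bar>z\<bar> powr (1 + lam)"
  have A: "?A = (\<lambda>z. \<bar>\<xi>\<bar> powr (1 + lam) * ?k (0 + \<xi> * z))"
    using False by (auto simp: abs_mult powr_mult)
  have k: "integral\<^sup>L lborel ?k = 1 / c_const lam"
    by (simp add: c_const_lborel)
  have "integral\<^sup>L lborel ?k = \<bar>\<xi>\<bar> * (LINT z|lborel. ?k (0 + \<xi> * z))"
    using lborel_integral_real_affine[OF False, of ?k 0] by simp
  then have *: "(LINT z|lborel. ?k (0 + \<xi> * z)) = 1 / c_const lam / \<bar>\<xi>\<bar>"
    using False by (simp add: k field_simps)
  have "integral\<^sup>L lborel ?A = \<bar>\<xi>\<bar> powr (1 + lam) * (LINT z|lborel. ?k (0 + \<xi> * z))"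
    unfolding A by (rule integral_mult_right_zero)
  also have "\<dots> = \<bar>\<xi>\<bar> powr lam / c_const lam"
    unfolding * using False by (simp add: powr_add)
  finally have AA: "integral\<^sup>L lborel ?A = \<bar>\<xi>\<bar> powr lam / c_const lam" .
  have "(LINT z:{z. \<bar>z\<bar> > 0}|lebesgue.
          (cos (\<xi> * (0 + z)) - cos (\<xi> * 0)) / \<bar>z\<bar> powr (1 + lam)) = (LINT z|lebesgue. - ?A z)"
    unfolding set_lebesgue_integral_def
    by (intro Bochner_Integration.integral_cong) (auto simp: indicator_def field_simps)
  also have "\<dots> = - integral\<^sup>L lborel ?A"
    by (subst integral_completion) auto
  finally show ?thesis
    using c_const_pos[OF lam] by (simp add: frac_lap_def AA)
qed (use lam in \<open>simp add: frac_lap_def\<close>)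

end

theory Submission
  imports Defs
begin

text \<open>
  By Fubini, the weights \<open>G i j\<close> depend only on \<open>j - i\<close>: they are integrals of the Levy kernel
  against increments of hat functions on the grid. The hat functions form a partition of unity, so the
  weights have total mass zero, are nonnegative off the diagonal, and the diagonal one is exactly
  \<open>- d_const lam * dx powr (1 - lam)\<close>, the quantity in the explicit CFL condition. Writing increments
  of the monotone flux as \<open>a * (u - u') - b * (v - v')\<close> with \<open>0 \<le> a \<le> F1\<close> and \<open>0 \<le> b \<le> F2\<close>, one time
  step becomes a linear map with nonnegative coefficients whose row and column sums are one (up to an
  inverse of the same kind in the implicit case). Row sums give the maximum principle, column sums the
  \<open>L1\<close> contraction; the contraction applied to the zero solution and to a translate by one cell gives (ii)
  and (iii). For (iv), a time step changes the solution by \<open>dt\<close> times the flux difference and the discrete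
  jump operator, both bounded in \<open>L1\<close> by \<open>L1\<close> norm and total variation: a jump by \<open>k\<close> cells costs at
  most \<open>\<bar>k\<bar>\<close> variations or twice the norm, and hat functions interpolate \<open>\<bar>k\<bar>\<close> exactly. For the
  initial data, the variation of the cell averages is the limit of testing \<open>u0\<close> with Steklov averages of
  combinations of hat functions.
\<close>


section \<open>Doubly infinite sequences\<close>

text \<open>Values in \<open>ennreal\<close> let the triangle inequality, shifts and exchanges of
  summation be stated for all sequences; finiteness is a separate condition
  \<open>l1 U < \<infinity>\<close>. The total variation of a grid function is
  \<open>l1 (fdiff U)\<close>.\<close>

definition l1 :: "(int \<Rightarrow> real) \<Rightarrow> ennreal" where
  "l1 U = (\<integral>\<^sup>+i. ennreal \<bar>U i\<bar> \<partial>count_space UNIV)"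

definition fdiff :: "(int \<Rightarrow> real) \<Rightarrow> int \<Rightarrow> real" where
  "fdiff U i = U (i + 1) - U i"

lemma nn_integral_int_shift:
  "(\<integral>\<^sup>+i. f (i + k) \<partial>count_space UNIV) = (\<integral>\<^sup>+i. f i \<partial>count_space (UNIV :: int set))"
  by (rule nn_integral_bij_count_space) (rule bij_betwI[where g = "\<lambda>i. i - k"], auto)

lemma l1_shift: "l1 (\<lambda>i. U (i + k)) = l1 U"
  unfolding l1_def by (rule nn_integral_int_shift)

lemma l1_mono: "(\<And>i. \<bar>U i\<bar> \<le> \<bar>V i\<bar>) \<Longrightarrow> l1 U \<le> l1 V"
  unfolding l1_def by (intro nn_integral_mono ennreal_leI) auto

lemma l1_cong_abs: "(\<And>i. \<bar>U i\<bar> = \<bar>V i\<bar>) \<Longrightarrow> l1 U = l1 V"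
  unfolding l1_def by simp

lemma l1_zero [simp]: "l1 (\<lambda>i. 0) = 0"
  unfolding l1_def by simp

lemma l1_triangle: "l1 (\<lambda>i. U i + V i) \<le> l1 U + l1 V"
proof -
  have "l1 (\<lambda>i. U i + V i) \<le> (\<integral>\<^sup>+i. ennreal \<bar>U i\<bar> + ennreal \<bar>V i\<bar> \<partial>count_space UNIV)"
    unfolding l1_def
    by (intro nn_integral_mono) (auto simp flip: ennreal_plus intro!: ennreal_leI)
  then show ?thesis
    unfolding l1_def by (simp add: nn_integral_add)
qed

lemma l1_triangle_diff: "l1 (\<lambda>i. U i - V i) \<le> l1 U + l1 V"
  using l1_triangle[of U "\<lambda>i. - V i"] l1_cong_abs[of "\<lambda>i. - V i" V] by simp

lemma l1_cmult: "l1 (\<lambda>i. c * U i) = ennreal \<bar>c\<bar> * l1 U"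
  unfolding l1_def abs_mult by (simp add: ennreal_mult nn_integral_cmult)

lemma abs_le_l1: "ennreal \<bar>U i\<bar> \<le> l1 U"
  unfolding l1_def by (rule nn_integral_ge_point) simp

lemma l1_finite_imp_bounded:
  assumes "l1 U < \<infinity>"
  shows "\<exists>M. \<forall>i. \<bar>U i\<bar> \<le> M"
proof (intro exI allI)
  fix i
  have "ennreal \<bar>U i\<bar> \<le> ennreal (enn2real (l1 U))"
    using abs_le_l1[of U i] assms by simp
  then show "\<bar>U i\<bar> \<le> enn2real (l1 U)" by simp
qed

lemma l1_finite_iff_abs_summable:
  "l1 U < \<infinity> \<longleftrightarrow> (\<lambda>i. \<bar>U i\<bar>) summable_on UNIV"
  using abs_summable_equivalent[of U UNIV]
  by (simp add: Infinite_Set_Sum.abs_summable_on_def integrable_iff_bounded l1_def)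

text \<open>For finite \<open>l1 U\<close> the infinite sum is an integral for the counting measure,
  and the norm inequality for integrals applies; otherwise the bound is \<open>top\<close>.\<close>

lemma abs_infsum_le_l1: "ennreal \<bar>\<Sum>\<^sub>\<infinity>i. U i\<bar> \<le> l1 U"
proof (cases "l1 U < \<infinity>")
  case True
  then have int: "integrable (count_space UNIV) U"
    by (simp add: integrable_iff_bounded l1_def)
  then have eq: "(\<Sum>\<^sub>\<infinity>i. U i) = integral\<^sup>L (count_space UNIV) U"
    using infsetsum_infsum[of U UNIV] by (simp add: Infinite_Set_Sum.abs_summable_on_def infsetsum_def)
  have "norm (integral\<^sup>L (count_space UNIV) U) \<le> (LINT i|count_space UNIV. norm (U i))"
    by (rule integral_norm_bound)
  then have "ennreal \<bar>\<Sum>\<^sub>\<infinity>i. U i\<bar> \<le> ennreal (LINT i|count_space UNIV. \<bar>U i\<bar>)"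
    unfolding eq by (simp add: ennreal_leI)
  also have "\<dots> = l1 U"
    unfolding l1_def using int by (intro nn_integral_eq_integral[symmetric]) auto
  finally show ?thesis .
next
  case False
  then have "l1 U = top" by (metis top.not_eq_extremum infinity_ennreal_def)
  then show ?thesis by simp
qed

text \<open>Telescope into unit shifts; by translation invariance each costs one total variation. A
  negative shift is read backwards, starting from the shifted cell.\<close>

lemma l1_shift_difference:
  "l1 (\<lambda>i. U (i + k) - U i) \<le> ennreal \<bar>of_int k\<bar> * l1 (fdiff U)"
proof -
  have *: "l1 (\<lambda>i. U (i + int n) - U i) \<le> of_nat n * l1 (fdiff U)" for n
  proof (induction n)
    case (Suc n)
    have "l1 (\<lambda>i. U (i + int (Suc n)) - U i)
        \<le> l1 (\<lambda>i. fdiff U (i + int n)) + l1 (\<lambda>i. U (i + int n) - U i)"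
      by (rule order_trans[OF _ l1_triangle]) (simp add: fdiff_def add_ac)
    also have "\<dots> \<le> l1 (fdiff U) + of_nat n * l1 (fdiff U)"
      using Suc unfolding l1_shift by (intro add_left_mono)
    finally show ?case by (simp add: algebra_simps)
  qed simp
  show ?thesis
  proof (cases "0 \<le> k")
    case True
    then show ?thesis
      using *[of "nat k"] by (simp add: ennreal_of_nat_eq_real_of_nat)
  next
    case False
    have "l1 (\<lambda>i. U (i + k) - U i) = l1 (\<lambda>i. U (i + k + int (nat (-k))) - U (i + k))"
      using False by (intro l1_cong_abs) (simp add: abs_minus_commute)
    also have "\<dots> = l1 (\<lambda>i. U (i + int (nat (-k))) - U i)"
      by (rule l1_shift)
    also have "\<dots> \<le> of_nat (nat (- k)) * l1 (fdiff U)" by (rule *)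
    finally show ?thesis
      using False by (simp add: ennreal_of_nat_eq_real_of_nat)
  qed
qed


section \<open>Discrete jump operators\<close>

text \<open>These are the rates of a translation invariant jump process on the grid: off the
  diagonal \<open>w k\<close> is the rate of jumps by \<open>k\<close> cells, and the diagonal entry
  balances the total rate \<open>W\<close>.\<close>

locale jump_weights =
  fixes w :: "int \<Rightarrow> real" and W :: real
  assumes W_nonneg: "0 \<le> W"
    and w_0: "w 0 = - W"
    and w_nonneg: "k \<noteq> 0 \<Longrightarrow> 0 \<le> w k"
    and nn_w: "(\<integral>\<^sup>+k. ennreal (w k) \<partial>count_space UNIV) = ennreal W"
begin

text \<open>\<open>w 0\<close> is nonpositive, so it does not contribute to the sum in \<open>nn_w\<close>, where
  \<open>ennreal\<close> truncates it to \<open>0\<close>.\<close>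

definition jump_op :: "(int \<Rightarrow> real) \<Rightarrow> int \<Rightarrow> real" where
  "jump_op U i = (\<Sum>\<^sub>\<infinity>k. w k * U (i + k))"

text \<open>\<open>max 0\<close> erases only the diagonal weight, the others being nonnegative. What
  is left is a positive operator, the inflow into a cell; the outflow is
  \<open>W * U i\<close>.\<close>

definition jump_gain :: "(int \<Rightarrow> real) \<Rightarrow> int \<Rightarrow> real" where
  "jump_gain U i = (\<Sum>\<^sub>\<infinity>k. max 0 (w k) * U (i + k))"

lemma ennreal_max_w [simp]: "ennreal (max 0 (w k)) = ennreal (w k)"
  by (simp add: ennreal_max_0)

lemma l1_gain_terms:
  "l1 (\<lambda>k. max 0 (w k) * U (i + k)) = (\<integral>\<^sup>+k. ennreal (w k) * ennreal \<bar>U (i + k)\<bar> \<partial>count_space UNIV)"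
  unfolding l1_def by (simp add: abs_mult ennreal_mult)

lemma l1_gain_terms_le:
  assumes "\<And>i. \<bar>U i\<bar> \<le> M"
  shows "l1 (\<lambda>k. max 0 (w k) * U (i + k)) \<le> ennreal (W * M)"
proof -
  have "0 \<le> M" using assms[of 0] by simp
  have "l1 (\<lambda>k. max 0 (w k) * U (i + k)) \<le> (\<integral>\<^sup>+k. ennreal (w k) * ennreal M \<partial>count_space UNIV)"
    unfolding l1_gain_terms using assms by (intro nn_integral_mono mult_left_mono ennreal_leI) auto
  also have "\<dots> = ennreal (W * M)"
    using W_nonneg \<open>0 \<le> M\<close> by (simp add: nn_integral_multc nn_w ennreal_mult)
  finally show ?thesis .
qed

lemma summable_gain_terms:
  assumes "\<And>i. \<bar>U i\<bar> \<le> M"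
  shows "(\<lambda>k. max 0 (w k) * U (i + k)) summable_on UNIV"
proof -
  have "l1 (\<lambda>k. max 0 (w k) * U (i + k)) < \<infinity>"
    using l1_gain_terms_le[OF assms, where i = i] by (rule le_less_trans) simp
  then show ?thesis
    unfolding l1_finite_iff_abs_summable
    by (subst summable_on_iff_abs_summable_on_real) (simp only: real_norm_def)
qed

lemma jump_gain_le:
  assumes "\<And>i. \<bar>U i\<bar> \<le> M"
  shows "\<bar>jump_gain U i\<bar> \<le> W * M"
proof -
  have "0 \<le> M" using assms[of 0] by simp
  have "ennreal \<bar>jump_gain U i\<bar> \<le> ennreal (W * M)"
    unfolding jump_gain_def using abs_infsum_le_l1 l1_gain_terms_le[OF assms] by (rule order_trans)
  then show ?thesis using W_nonneg \<open>0 \<le> M\<close> by simp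
qed

text \<open>Boundedness makes the inflow series summable, so the single diagonal term can be split
  off.\<close>

lemma jump_op_eq_gain:
  assumes "\<And>i. \<bar>U i\<bar> \<le> M"
  shows "jump_op U i = jump_gain U i - W * U i"
proof -
  have "w k * U (i + k) = max 0 (w k) * U (i + k) + (if k = 0 then - W * U i else 0)" for k
    using w_nonneg[of k] W_nonneg w_0 by (cases "k = 0") auto
  then have "jump_op U i = (\<Sum>\<^sub>\<infinity>k. max 0 (w k) * U (i + k) + (if k = 0 then - W * U i else 0))"
    unfolding jump_op_def by (intro infsum_cong) blast
  also have "\<dots> = jump_gain U i + (\<Sum>\<^sub>\<infinity>k::int. if k = 0 then - W * U i else 0)"
    unfolding jump_gain_def
    using has_sum_finite_neutralI[of "{0}" UNIV "\<lambda>k::int. if k = 0 then - W * U i else 0"]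
    by (intro infsum_add summable_gain_terms[OF assms]) (auto intro: has_sum_imp_summable)
  also have "(\<Sum>\<^sub>\<infinity>k::int. if k = 0 then - W * U i else 0) = - W * U i"
    using infsum_cong_neutral[of UNIV "{0}" "\<lambda>k::int. if k = 0 then - W * U i else 0" "\<lambda>k. - W * U i"]
    by simp
  finally show ?thesis by simp
qed

lemma jump_gain_diff:
  assumes "\<And>i. \<bar>U i\<bar> \<le> M" "\<And>i. \<bar>V i\<bar> \<le> N"
  shows "jump_gain (\<lambda>i. U i - V i) i = jump_gain U i - jump_gain V i"
proof -
  have *: "(\<lambda>k. max 0 (w k) * - V (i + k)) summable_on UNIV"
    using summable_gain_terms[of "\<lambda>i. - V i" N i] assms by simp
  have "jump_gain (\<lambda>i. U i - V i) i
      = (\<Sum>\<^sub>\<infinity>k. max 0 (w k) * U (i + k) + max 0 (w k) * - V (i + k))"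
    unfolding jump_gain_def right_diff_distrib by simp
  also have "\<dots> = jump_gain U i + (\<Sum>\<^sub>\<infinity>k. max 0 (w k) * - V (i + k))"
    unfolding jump_gain_def by (intro infsum_add summable_gain_terms[OF assms(1)] *)
  also have "(\<Sum>\<^sub>\<infinity>k. max 0 (w k) * - V (i + k)) = - jump_gain V i"
    unfolding jump_gain_def by (simp add: infsum_uminus)
  finally show ?thesis by simp
qed

text \<open>Tonelli over pairs of cells. The family \<open>V\<close> is general so that translates
  of a sequence as well as their differences from it can be inserted.\<close>

lemma l1_gain_swap:
  "(\<integral>\<^sup>+i. l1 (\<lambda>k. max 0 (w k) * V k i) \<partial>count_space UNIV)
    = (\<integral>\<^sup>+k. ennreal (w k) * l1 (V k) \<partial>count_space UNIV)"
proof -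
  have "(\<integral>\<^sup>+i. l1 (\<lambda>k. max 0 (w k) * V k i) \<partial>count_space UNIV)
      = (\<integral>\<^sup>+i. \<integral>\<^sup>+k. ennreal (w k) * ennreal \<bar>V k i\<bar> \<partial>count_space UNIV \<partial>count_space UNIV)"
    unfolding l1_def by (simp add: abs_mult ennreal_mult)
  also have "\<dots> = (\<integral>\<^sup>+k. \<integral>\<^sup>+i. ennreal (w k) * ennreal \<bar>V k i\<bar> \<partial>count_space UNIV \<partial>count_space UNIV)"
    by (rule nn_integral_count_space_nn_integral) auto
  finally show ?thesis
    by (simp add: nn_integral_cmult l1_def)
qed

text \<open>Column sums: after the swap every translate has the same norm, and the rates add up to
  \<open>W\<close>.\<close>

lemma l1_jump_gain_le: "l1 (jump_gain U) \<le> ennreal W * l1 U"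
proof -
  have "l1 (jump_gain U) \<le> (\<integral>\<^sup>+i. l1 (\<lambda>k. max 0 (w k) * U (i + k)) \<partial>count_space UNIV)"
    unfolding l1_def[of "jump_gain U"] jump_gain_def by (intro nn_integral_mono abs_infsum_le_l1)
  also have "\<dots> = (\<integral>\<^sup>+k. ennreal (w k) * l1 (\<lambda>i. U (i + k)) \<partial>count_space UNIV)"
    by (rule l1_gain_swap)
  also have "\<dots> = ennreal W * l1 U"
    unfolding l1_shift by (simp add: nn_integral_multc nn_w)
  finally show ?thesis .
qed

text \<open>The weights have total mass zero, so the operator only sees differences.\<close>

lemma l1_jump_op_le:
  assumes "\<And>i. \<bar>U i\<bar> \<le> M"
  shows "l1 (jump_op U) \<le> (\<integral>\<^sup>+k. ennreal (w k) * l1 (\<lambda>i. U (i + k) - U i) \<partial>count_space UNIV)"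
proof -
  have int: "integrable (count_space UNIV) (\<lambda>k. max 0 (w k))"
    using nn_w by (simp add: integrable_iff_bounded)
  have W: "(\<Sum>\<^sub>\<infinity>k. max 0 (w k)) = W"
  proof -
    have "(\<Sum>\<^sub>\<infinity>k. max 0 (w k)) = (LINT k|count_space UNIV. max 0 (w k))"
      using infsetsum_infsum[of "\<lambda>k. max 0 (w k)" UNIV] int
      by (simp add: Infinite_Set_Sum.abs_summable_on_def infsetsum_def)
    also have "ennreal (LINT k|count_space UNIV. max 0 (w k)) = ennreal W"
      using nn_integral_eq_integral[OF int] by (simp add: nn_w)
    then have "(LINT k|count_space UNIV. max 0 (w k)) = W"
      using W_nonneg by (subst (asm) ennreal_inj) auto
    finally show ?thesis .
  qed
  have "jump_op U i = (\<Sum>\<^sub>\<infinity>k. max 0 (w k) * (U (i + k) - U i))" for i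
  proof -
    have "(\<lambda>k. max 0 (w k)) summable_on UNIV"
      using summable_gain_terms[of "\<lambda>_. 1" 1] by simp
    then have s: "(\<lambda>k. max 0 (w k) * - U i) summable_on UNIV"
      by (rule summable_on_cmult_left)
    have "(\<Sum>\<^sub>\<infinity>k. max 0 (w k) * (U (i + k) - U i))
        = (\<Sum>\<^sub>\<infinity>k. max 0 (w k) * U (i + k) + max 0 (w k) * - U i)"
      unfolding right_diff_distrib by simp
    also have "\<dots> = jump_gain U i + (\<Sum>\<^sub>\<infinity>k. max 0 (w k) * - U i)"
      unfolding jump_gain_def by (intro infsum_add summable_gain_terms[OF assms] s)
    also have "(\<Sum>\<^sub>\<infinity>k. max 0 (w k) * - U i) = - W * U i"
      using infsum_cmult_left'[of "\<lambda>k. max 0 (w k)" "- U i" UNIV] W by simp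
    finally show ?thesis using jump_op_eq_gain[OF assms] by simp
  qed
  then have "l1 (jump_op U) \<le> (\<integral>\<^sup>+i. l1 (\<lambda>k. max 0 (w k) * (U (i + k) - U i)) \<partial>count_space UNIV)"
    unfolding l1_def[of "jump_op U"] by (auto intro!: nn_integral_mono abs_infsum_le_l1)
  also have "\<dots> = (\<integral>\<^sup>+k. ennreal (w k) * l1 (\<lambda>i. U (i + k) - U i) \<partial>count_space UNIV)"
    by (rule l1_gain_swap)
  finally show ?thesis .
qed

end


section \<open>Monotone fluxes\<close>

locale monotone_flux =
  fixes F :: "real \<Rightarrow> real \<Rightarrow> real" and F1 F2 :: real
  assumes F1_pos: "0 < F1" and F2_pos: "0 < F2"
    and F_mono: "\<And>b. mono (\<lambda>a. F a b)"
    and F_antimono: "\<And>a. antimono (\<lambda>b. F a b)"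
    and F_lipschitz1: "\<And>b. F1-lipschitz_on UNIV (\<lambda>a. F a b)"
    and F_lipschitz2: "\<And>a. F2-lipschitz_on UNIV (\<lambda>b. F a b)"
begin

definition flux_step :: "real \<Rightarrow> (int \<Rightarrow> real) \<Rightarrow> int \<Rightarrow> real" where
  "flux_step r U i = U i - r * (F (U i) (U (i + 1)) - F (U (i - 1)) (U i))"

text \<open>Change one argument at a time, passing through \<open>F u' v\<close>. The difference
  quotients are signed by monotonicity and bounded by the Lipschitz constants; for equal arguments
  the quotient is a division by zero, hence 0, which also fits.\<close>

lemma flux_increment:
  "\<exists>a b. 0 \<le> a \<and> a \<le> F1 \<and> 0 \<le> b \<and> b \<le> F2 \<and> F u v - F u' v' = a * (u - u') - b * (v - v')"
proof -
  define a where "a = (F u v - F u' v) / (u - u')"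
  define b where "b = - (F u' v - F u' v') / (v - v')"
  have "0 \<le> a"
    unfolding a_def using monoD[OF F_mono[of v], of u u'] monoD[OF F_mono[of v], of u' u]
    by (cases "u \<le> u'") (auto simp: zero_le_divide_iff)
  moreover have "a \<le> F1"
    using lipschitz_onD[OF F_lipschitz1[of v], of u u'] F1_pos abs_le_D1[of a F1]
    by (cases "u = u'") (auto simp: a_def dist_real_def abs_divide divide_le_eq)
  moreover have "0 \<le> b"
    unfolding b_def using antimonoD[OF F_antimono[of u'], of v v'] antimonoD[OF F_antimono[of u'], of v' v]
    by (cases "v \<le> v'") (auto simp: zero_le_divide_iff divide_le_0_iff)
  moreover have "b \<le> F2"
    using lipschitz_onD[OF F_lipschitz2[of u'], of v v'] F2_pos abs_le_D1[of b F2]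
    by (cases "v = v'") (auto simp: b_def dist_real_def abs_divide divide_le_eq)
  moreover have "F u v - F u' v' = a * (u - u') - b * (v - v')"
    by (cases "u = u'"; cases "v = v'") (auto simp: a_def b_def)
  ultimately show ?thesis by blast
qed

text \<open>The coefficients \<open>a i\<close> and \<open>b i\<close> belong to the interface
  between the cells \<open>i\<close> and \<open>i + 1\<close>, so the same pair enters the updates
  of both cells. This is what makes the column sums equal to one.\<close>

lemma flux_step_diff:
  obtains a b :: "int \<Rightarrow> real" where
    "\<And>i. 0 \<le> a i" "\<And>i. a i \<le> F1" "\<And>i. 0 \<le> b i" "\<And>i. b i \<le> F2"
    "\<And>i. flux_step r U i - flux_step r V i = (1 - r * (a i + b (i - 1))) * (U i - V i)
       + r * b i * (U (i + 1) - V (i + 1)) + r * a (i - 1) * (U (i - 1) - V (i - 1))"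
proof -
  obtain a b where ab: "\<And>i. 0 \<le> a i \<and> a i \<le> F1 \<and> 0 \<le> b i \<and> b i \<le> F2 \<and>
      F (U i) (U (i + 1)) - F (V i) (V (i + 1)) = a i * (U i - V i) - b i * (U (i + 1) - V (i + 1))"
  proof -
    have "\<forall>i. \<exists>a b. 0 \<le> a \<and> a \<le> F1 \<and> 0 \<le> b \<and> b \<le> F2 \<and>
      F (U i) (U (i + 1)) - F (V i) (V (i + 1)) = a * (U i - V i) - b * (U (i + 1) - V (i + 1))"
      using flux_increment by blast
    from choice[OF this] obtain a where "\<forall>i. \<exists>b. 0 \<le> a i \<and> a i \<le> F1 \<and> 0 \<le> b \<and> b \<le> F2 \<and>
      F (U i) (U (i + 1)) - F (V i) (V (i + 1)) = a i * (U i - V i) - b * (U (i + 1) - V (i + 1))" ..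
    from choice[OF this] show thesis using that by blast
  qed
  have "flux_step r U i - flux_step r V i = (1 - r * (a i + b (i - 1))) * (U i - V i)
       + r * b i * (U (i + 1) - V (i + 1)) + r * a (i - 1) * (U (i - 1) - V (i - 1))" for i
  proof -
    have "F (U (i - 1)) (U i) - F (V (i - 1)) (V i)
        = a (i - 1) * (U (i - 1) - V (i - 1)) - b (i - 1) * (U i - V i)"
      using ab[of "i - 1"] by simp
    moreover have "F (U i) (U (i + 1)) - F (V i) (V (i + 1))
        = a i * (U i - V i) - b i * (U (i + 1) - V (i + 1))"
      using ab[of i] by simp
    ultimately have F: "F (U (i - 1)) (U i) = F (V (i - 1)) (V i)
        + (a (i - 1) * (U (i - 1) - V (i - 1)) - b (i - 1) * (U i - V i))"
      "F (U i) (U (i + 1)) = F (V i) (V (i + 1)) + (a i * (U i - V i) - b i * (U (i + 1) - V (i + 1)))"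
      by linarith+
    show ?thesis
      unfolding flux_step_def F by (simp add: algebra_simps)
  qed
  with ab that show thesis by metis
qed

text \<open>The coefficients of each \<open>D j\<close> are nonnegative and, collected over all cells, sum up to at most
  one: what leaves a cell enters its neighbours.\<close>

lemma l1_increment_le:
  fixes a b D E G :: "int \<Rightarrow> real"
  assumes ab: "\<And>i. 0 \<le> a i" "\<And>i. a i \<le> F1" "\<And>i. 0 \<le> b i" "\<And>i. b i \<le> F2"
    and r: "0 \<le> r" and m: "0 \<le> m" and CFL: "(F1 + F2) * r + m \<le> 1"
    and G: "l1 G \<le> ennreal m * l1 D"
    and E: "\<And>i. E i = (1 - r * (a i + b (i - 1)) - m) * D i
       + r * b i * D (i + 1) + r * a (i - 1) * D (i - 1) + G i"
  shows "l1 E \<le> l1 D"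
proof -
  define c where "c i = 1 - r * (a i + b (i - 1)) - m" for i
  have c: "0 \<le> c i" for i
  proof -
    have "r * (a i + b (i - 1)) \<le> r * (F1 + F2)"
      using ab r by (intro mult_left_mono add_mono)
    then show ?thesis using CFL unfolding c_def by (simp add: mult.commute)
  qed
  \<comment> \<open>Contributions are indexed by the cell they come from: \<open>A i\<close> is what
    cell \<open>i\<close> sends to its left neighbour and \<open>B i\<close> what it sends to its
    right one. Shifting the summation index then collects the columns.\<close>
  define A where "A i = ennreal (r * b (i - 1) * \<bar>D i\<bar>)" for i
  define B where "B i = ennreal (r * a i * \<bar>D i\<bar>)" for i
  have "l1 E \<le> (\<integral>\<^sup>+i. ennreal (c i * \<bar>D i\<bar>) + A (i + 1) + B (i + - 1) + ennreal \<bar>G i\<bar>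
      \<partial>count_space UNIV)"
    unfolding l1_def
  proof (rule nn_integral_mono)
    fix i
    have "\<bar>E i\<bar> \<le> c i * \<bar>D i\<bar> + r * b i * \<bar>D (i + 1)\<bar> + r * a (i - 1) * \<bar>D (i - 1)\<bar> + \<bar>G i\<bar>"
    proof -
      have "\<bar>E i\<bar> \<le> \<bar>c i * D i\<bar> + \<bar>r * b i * D (i + 1)\<bar> + \<bar>r * a (i - 1) * D (i - 1)\<bar> + \<bar>G i\<bar>"
        unfolding E c_def by linarith
      also have "\<dots> = c i * \<bar>D i\<bar> + r * b i * \<bar>D (i + 1)\<bar> + r * a (i - 1) * \<bar>D (i - 1)\<bar> + \<bar>G i\<bar>"
        using c[of i] ab r by (simp add: abs_mult)
      finally show ?thesis .
    qed
    then show "ennreal \<bar>E i\<bar> \<le> ennreal (c i * \<bar>D i\<bar>) + A (i + 1) + B (i + - 1) + ennreal \<bar>G i\<bar>"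
      unfolding A_def B_def using c ab r by (simp add: ennreal_leI flip: ennreal_plus)
  qed
  also have "\<dots> = (\<integral>\<^sup>+i. ennreal (c i * \<bar>D i\<bar>) \<partial>count_space UNIV)
      + (\<integral>\<^sup>+i. A i \<partial>count_space UNIV) + (\<integral>\<^sup>+i. B i \<partial>count_space UNIV) + l1 G"
    by (simp add: nn_integral_add l1_def nn_integral_int_shift[of A 1] nn_integral_int_shift[of B "-1", simplified])
  also have "(\<integral>\<^sup>+i. ennreal (c i * \<bar>D i\<bar>) \<partial>count_space UNIV)
      + (\<integral>\<^sup>+i. A i \<partial>count_space UNIV) + (\<integral>\<^sup>+i. B i \<partial>count_space UNIV)
      = (\<integral>\<^sup>+i. ennreal (c i * \<bar>D i\<bar>) + A i + B i \<partial>count_space UNIV)"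
    by (simp add: nn_integral_add)
  also have "\<dots> = (\<integral>\<^sup>+i. ennreal (1 - m) * ennreal \<bar>D i\<bar> \<partial>count_space UNIV)"
  proof (intro nn_integral_cong)
    fix i
    have "1 - m \<ge> 0" using CFL F1_pos F2_pos r mult_nonneg_nonneg[of "F1 + F2" r] by linarith
    moreover have "c i * \<bar>D i\<bar> + r * b (i - 1) * \<bar>D i\<bar> + r * a i * \<bar>D i\<bar> = (1 - m) * \<bar>D i\<bar>"
      unfolding c_def by (simp add: algebra_simps)
    ultimately show "ennreal (c i * \<bar>D i\<bar>) + A i + B i = ennreal (1 - m) * ennreal \<bar>D i\<bar>"
      unfolding A_def B_def using c ab r by (simp flip: ennreal_plus ennreal_mult)
  qed
  also have "\<dots> = ennreal (1 - m) * l1 D"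
    unfolding l1_def by (simp add: nn_integral_cmult)
  also have "ennreal (1 - m) * l1 D + l1 G \<le> ennreal (1 - m) * l1 D + ennreal m * l1 D"
    using G by (rule add_left_mono)
  also have "\<dots> = l1 D"
  proof -
    have "1 - m \<ge> 0" using CFL F1_pos F2_pos r mult_nonneg_nonneg[of "F1 + F2" r] by linarith
    then have "ennreal (1 - m) + ennreal m = 1"
      using m by (simp flip: ennreal_plus)
    then show ?thesis by (metis distrib_right mult_1)
  qed
  finally show ?thesis .
qed

lemma flux_step_l1_contraction:
  assumes "0 \<le> r" "(F1 + F2) * r \<le> 1"
  shows "l1 (\<lambda>i. flux_step r U i - flux_step r V i) \<le> l1 (\<lambda>i. U i - V i)"
proof -
  obtain a b where ab: "\<And>i. 0 \<le> a i" "\<And>i. a i \<le> F1" "\<And>i. 0 \<le> b i" "\<And>i. b i \<le> F2"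
    "\<And>i. flux_step r U i - flux_step r V i = (1 - r * (a i + b (i - 1))) * (U i - V i)
       + r * b i * (U (i + 1) - V (i + 1)) + r * a (i - 1) * (U (i - 1) - V (i - 1))"
    using flux_step_diff[of r U V] by metis
  show ?thesis
    by (rule l1_increment_le[where a = a and b = b and r = r and m = 0 and G = "\<lambda>_. 0"])
      (use ab assms in auto)
qed

lemma flux_step_const: "flux_step r (\<lambda>_. c) i = c"
  by (simp add: flux_step_def)

text \<open>The coefficients of \<open>flux_step_diff\<close> have unit column sums but in general
  not unit row sums. Here both interface fluxes are compared with \<open>F (U i) (U i)\<close>
  instead, which gives nonnegative coefficients with row sum \<open>1 - m\<close>. The term
  \<open>m * U i\<close> makes room for the outflow of the jump operator.\<close>

lemma flux_step_le:
  assumes "0 \<le> r" "(F1 + F2) * r + m \<le> 1" "0 \<le> m" "\<And>i. \<bar>U i\<bar> \<le> M"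
  shows "\<bar>flux_step r U i - m * U i\<bar> \<le> (1 - m) * M"
proof -
  have "0 \<le> M" using assms(4)[of 0] by simp
  obtain a b where a: "0 \<le> a" "a \<le> F1" and 1: "F (U (i - 1)) (U i) - F (U i) (U i) = a * (U (i - 1) - U i)"
    using flux_increment[of "U (i - 1)" "U i" "U i" "U i"] by auto
  obtain a' b where b: "0 \<le> b" "b \<le> F2" and 2: "F (U i) (U (i + 1)) - F (U i) (U i) = - b * (U (i + 1) - U i)"
    using flux_increment[of "U i" "U (i + 1)" "U i" "U i"] by auto
  have F: "F (U (i - 1)) (U i) = F (U i) (U i) + a * (U (i - 1) - U i)"
    "F (U i) (U (i + 1)) = F (U i) (U i) - b * (U (i + 1) - U i)"
    using 1 2 by linarith+
  have eq: "flux_step r U i - m * U i = (1 - r * (a + b) - m) * U i + r * b * U (i + 1) + r * a * U (i - 1)"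
    unfolding flux_step_def F by (simp add: algebra_simps)
  have "r * (a + b) \<le> r * (F1 + F2)"
    using a b assms by (intro mult_left_mono add_mono)
  then have c: "0 \<le> 1 - r * (a + b) - m" using assms by (simp add: mult.commute)
  have "\<bar>flux_step r U i - m * U i\<bar>
      \<le> \<bar>(1 - r * (a + b) - m) * U i\<bar> + \<bar>r * b * U (i + 1)\<bar> + \<bar>r * a * U (i - 1)\<bar>"
    unfolding eq by linarith
  also have "\<dots> = (1 - r * (a + b) - m) * \<bar>U i\<bar> + r * b * \<bar>U (i + 1)\<bar> + r * a * \<bar>U (i - 1)\<bar>"
    using c a b assms by (simp add: abs_mult)
  also have "\<dots> \<le> (1 - r * (a + b) - m) * M + r * b * M + r * a * M"
    using c a b assms by (intro add_mono mult_left_mono) auto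
  also have "\<dots> = (1 - m) * M" by (simp add: algebra_simps)
  finally show ?thesis .
qed

lemma l1_flux_difference_le:
  "l1 (\<lambda>i. F (U i) (U (i + 1)) - F (U (i - 1)) (U i)) \<le> ennreal (F1 + F2) * l1 (fdiff U)"
proof -
  have "l1 (\<lambda>i. F (U i) (U (i + 1)) - F (U (i - 1)) (U i))
      \<le> l1 (\<lambda>i. F1 * \<bar>fdiff U (i + - 1)\<bar> + F2 * \<bar>fdiff U i\<bar>)"
  proof (rule l1_mono)
    fix i
    obtain a b where *: "0 \<le> a" "a \<le> F1" "0 \<le> b" "b \<le> F2"
      "F (U i) (U (i + 1)) - F (U (i - 1)) (U i) = a * (U i - U (i - 1)) - b * (U (i + 1) - U i)"
      using flux_increment by metis
    have "\<bar>F (U i) (U (i + 1)) - F (U (i - 1)) (U i)\<bar> \<le> a * \<bar>fdiff U (i - 1)\<bar> + b * \<bar>fdiff U i\<bar>"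
      unfolding *(5) using *(1,3) abs_triangle_ineq4[of "a * (U i - U (i - 1))" "b * (U (i + 1) - U i)"]
      by (simp add: fdiff_def abs_mult)
    also have "\<dots> \<le> F1 * \<bar>fdiff U (i - 1)\<bar> + F2 * \<bar>fdiff U i\<bar>"
      using * by (intro add_mono mult_right_mono) auto
    finally show "\<bar>F (U i) (U (i + 1)) - F (U (i - 1)) (U i)\<bar>
        \<le> \<bar>F1 * \<bar>fdiff U (i + - 1)\<bar> + F2 * \<bar>fdiff U i\<bar>\<bar>" by simp
  qed
  also have "\<dots> \<le> l1 (\<lambda>i. F1 * \<bar>fdiff U (i + - 1)\<bar>) + l1 (\<lambda>i. F2 * \<bar>fdiff U i\<bar>)"
    by (rule l1_triangle)
  also have "\<dots> = ennreal F1 * l1 (fdiff U) + ennreal F2 * l1 (fdiff U)"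
    using F1_pos F2_pos l1_cong_abs[of "\<lambda>i. \<bar>fdiff U i\<bar>" "fdiff U"]
      l1_cong_abs[of "\<lambda>i. \<bar>fdiff U (i + - 1)\<bar>" "\<lambda>i. fdiff U (i + - 1)"] l1_shift[of "fdiff U" "-1"]
    unfolding l1_cmult by simp
  also have "\<dots> = ennreal (F1 + F2) * l1 (fdiff U)"
    using F1_pos F2_pos by (simp add: distrib_right)
  finally show ?thesis .
qed

end


section \<open>Stability of the two time steps\<close>

text \<open>\<open>r\<close> stands for the ratio of time step to cell width. The weights are
  integrals over a cell, so \<open>r * jump_op\<close> already contains the averaging
  factor.\<close>

locale monotone_scheme = jump_weights w W + monotone_flux F F1 F2
  for w W F F1 F2 +
  fixes r :: real
  assumes r_nonneg: "0 \<le> r"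
begin

text \<open>The first alternative is the explicit step, the second the implicit-explicit one. Each
  carries its own CFL condition, so that iteration can treat both methods at once.\<close>

definition scheme_step :: "(int \<Rightarrow> real) \<Rightarrow> (int \<Rightarrow> real) \<Rightarrow> bool" where
  "scheme_step U V \<longleftrightarrow>
     (F1 + F2) * r + r * W \<le> 1 \<and> (\<forall>i. V i = flux_step r U i + r * jump_op U i) \<or>
     (F1 + F2) * r \<le> 1 \<and> l1 V < \<infinity> \<and> (\<forall>i. V i = flux_step r U i + r * jump_op V i)"

text \<open>The outflow lowers the diagonal coefficient by \<open>r * W\<close>, which the CFL
  condition keeps nonnegative, and the inflow returns at most this mass:
  \<open>l1_increment_le\<close> with \<open>m = r * W\<close>.\<close>

lemma explicit_contraction:
  assumes CFL: "(F1 + F2) * r + r * W \<le> 1"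
    and U: "l1 U < \<infinity>" "\<And>i. U' i = flux_step r U i + r * jump_op U i"
    and V: "l1 V < \<infinity>" "\<And>i. V' i = flux_step r V i + r * jump_op V i"
  shows "l1 (\<lambda>i. U' i - V' i) \<le> l1 (\<lambda>i. U i - V i)"
proof -
  obtain M N where M: "\<And>i. \<bar>U i\<bar> \<le> M" and N: "\<And>i. \<bar>V i\<bar> \<le> N"
    using l1_finite_imp_bounded U(1) V(1) by metis
  obtain a b where ab: "\<And>i. 0 \<le> a i" "\<And>i. a i \<le> F1" "\<And>i. 0 \<le> b i" "\<And>i. b i \<le> F2"
    "\<And>i. flux_step r U i - flux_step r V i = (1 - r * (a i + b (i - 1))) * (U i - V i)
       + r * b i * (U (i + 1) - V (i + 1)) + r * a (i - 1) * (U (i - 1) - V (i - 1))"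
    using flux_step_diff[of r U V] by metis
  let ?D = "\<lambda>i. U i - V i"
  have G: "l1 (\<lambda>i. r * jump_gain ?D i) \<le> ennreal (r * W) * l1 ?D"
    unfolding l1_cmult using r_nonneg l1_jump_gain_le[of ?D] W_nonneg
    by (simp add: ennreal_mult mult.assoc mult_left_mono)
  have E: "U' i - V' i = (1 - r * (a i + b (i - 1)) - r * W) * ?D i
       + r * b i * ?D (i + 1) + r * a (i - 1) * ?D (i - 1) + r * jump_gain ?D i" for i
    using ab(5)[of i] unfolding U V jump_gain_diff[OF M N] jump_op_eq_gain[OF M] jump_op_eq_gain[OF N]
    by (simp add: algebra_simps)
  show ?thesis
    by (rule l1_increment_le[OF ab(1-4) r_nonneg _ CFL G E]) (use r_nonneg W_nonneg in auto)
qed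

text \<open>Moving the outflow to the left gives
  \<open>(1 + r * W) * D = H + r * jump_gain D\<close>, where \<open>D\<close> is the new difference
  and \<open>H\<close> the difference of the flux steps. The inflow costs at most
  \<open>r * W\<close> times the norm of \<open>D\<close>, the same as the extra term on the
  left.\<close>

lemma implicit_contraction:
  assumes CFL: "(F1 + F2) * r \<le> 1"
    and U: "l1 U' < \<infinity>" "\<And>i. U' i = flux_step r U i + r * jump_op U' i"
    and V: "l1 V' < \<infinity>" "\<And>i. V' i = flux_step r V i + r * jump_op V' i"
  shows "l1 (\<lambda>i. U' i - V' i) \<le> l1 (\<lambda>i. U i - V i)"
proof -
  obtain M N where M: "\<And>i. \<bar>U' i\<bar> \<le> M" and N: "\<And>i. \<bar>V' i\<bar> \<le> N"
    using l1_finite_imp_bounded U(1) V(1) by metis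
  let ?D = "\<lambda>i. U' i - V' i" and ?H = "\<lambda>i. flux_step r U i - flux_step r V i"
  have eq: "(1 + r * W) * ?D i = ?H i + r * jump_gain ?D i" for i
    using U(2)[of i] V(2)[of i]
    unfolding jump_gain_diff[OF M N] jump_op_eq_gain[OF M] jump_op_eq_gain[OF N]
    by (simp add: algebra_simps)
  have fin: "l1 ?D < \<infinity>"
    by (rule le_less_trans[OF l1_triangle_diff]) (use U(1) V(1) in simp)
  have rW: "0 \<le> r * W" using r_nonneg W_nonneg by simp
  have "l1 ?D + ennreal (r * W) * l1 ?D = ennreal (1 + r * W) * l1 ?D"
    using rW by (simp add: distrib_right)
  also have "\<dots> = l1 (\<lambda>i. ?H i + r * jump_gain ?D i)"
    unfolding eq[symmetric] using rW by (simp add: l1_cmult)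
  also have "\<dots> \<le> l1 ?H + l1 (\<lambda>i. r * jump_gain ?D i)"
    by (rule l1_triangle)
  also have "\<dots> \<le> l1 ?H + ennreal (r * W) * l1 ?D"
    unfolding l1_cmult using r_nonneg l1_jump_gain_le[of ?D] W_nonneg
    by (simp add: ennreal_mult mult.assoc mult_left_mono add_left_mono)
  \<comment> \<open>Cancelling in \<open>ennreal\<close> needs a finite term; this is where the
    summability of the new time level enters.\<close>
  finally have "l1 ?D \<le> l1 ?H"
    using fin ennreal_add_left_cancel_le[of "ennreal (r * W) * l1 ?D" "l1 ?D" "l1 ?H"]
    by (auto simp: add.commute ennreal_mult_eq_top_iff top.not_eq_extremum)
  also have "\<dots> \<le> l1 (\<lambda>i. U i - V i)"
    by (rule flux_step_l1_contraction[OF r_nonneg CFL])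
  finally show ?thesis .
qed

section \<open>Maximum principle, norm, variation and increment for one time step\<close>

lemma scheme_step_maximum:
  assumes step: "scheme_step U V" and M: "\<And>i. \<bar>U i\<bar> \<le> M"
  shows "\<bar>V i\<bar> \<le> M"
  using step[unfolded scheme_step_def]
proof (elim disjE conjE)
  assume CFL: "(F1 + F2) * r + r * W \<le> 1" and V: "\<forall>i. V i = flux_step r U i + r * jump_op U i"
  have "V i = flux_step r U i - r * W * U i + r * jump_gain U i"
    using V jump_op_eq_gain[OF M] by (simp add: algebra_simps)
  then have "\<bar>V i\<bar> \<le> \<bar>flux_step r U i - r * W * U i\<bar> + r * \<bar>jump_gain U i\<bar>"
    using abs_triangle_ineq[of "flux_step r U i - r * W * U i" "r * jump_gain U i"] r_nonneg
    by (simp add: abs_mult)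
  \<comment> \<open>Row sums: the flux part minus the outflow contributes \<open>1 - r * W\<close>,
    the inflow \<open>r * W\<close>.\<close>
  also have "\<dots> \<le> (1 - r * W) * M + r * (W * M)"
    using r_nonneg W_nonneg M CFL by (intro add_mono mult_left_mono flux_step_le jump_gain_le) auto
  finally show ?thesis by (simp add: algebra_simps)
next
  assume CFL: "(F1 + F2) * r \<le> 1" and "l1 V < \<infinity>"
    and V: "\<forall>i. V i = flux_step r U i + r * jump_op V i"
  obtain N where N: "\<And>i. \<bar>V i\<bar> \<le> N"
    using l1_finite_imp_bounded \<open>l1 V < \<infinity>\<close> by metis
  have rW: "0 \<le> r * W" using r_nonneg W_nonneg by simp
  \<comment> \<open>The inflow involves the unknown level itself and is bounded through its
    supremum. The estimate in each cell becomes
    \<open>S \<le> (M + r * W * S) / (1 + r * W)\<close>, which forces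
    \<open>S \<le> M\<close>.\<close>
  define S where "S = (SUP i. \<bar>V i\<bar>)"
  have bdd: "bdd_above (range (\<lambda>i. \<bar>V i\<bar>))" using N by (auto simp: bdd_above_def)
  have S: "\<bar>V j\<bar> \<le> S" for j unfolding S_def by (rule cSUP_upper[OF _ bdd]) simp
  have "\<bar>V j\<bar> \<le> (M + r * W * S) / (1 + r * W)" for j
  proof -
    have "(1 + r * W) * V j = flux_step r U j + r * jump_gain V j"
      using V[rule_format, of j] jump_op_eq_gain[where U = V and i = j, OF N] by (simp add: algebra_simps)
    then have "(1 + r * W) * \<bar>V j\<bar> = \<bar>flux_step r U j + r * jump_gain V j\<bar>"
      using rW by (metis abs_mult abs_of_nonneg add_nonneg_nonneg zero_le_one)
    also have "\<dots> \<le> \<bar>flux_step r U j\<bar> + r * \<bar>jump_gain V j\<bar>"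
      using abs_triangle_ineq[of "flux_step r U j" "r * jump_gain V j"] r_nonneg by (simp add: abs_mult)
    also have "\<dots> \<le> M + r * (W * S)"
      using flux_step_le[OF r_nonneg, of 0 U M] CFL M r_nonneg
      by (intro add_mono mult_left_mono jump_gain_le S) auto
    finally show ?thesis using rW by (simp add: field_simps)
  qed
  then have "S \<le> (M + r * W * S) / (1 + r * W)"
    unfolding S_def by (intro cSUP_least) auto
  then have "S \<le> M" using rW by (simp add: field_simps)
  with S[of i] show ?thesis by simp
qed

lemma scheme_step_l1:
  assumes "scheme_step U V" "l1 U < \<infinity>"
  shows "l1 V \<le> l1 U"
  using assms(1)[unfolded scheme_step_def]
proof (elim disjE conjE)
  assume CFL: "(F1 + F2) * r + r * W \<le> 1" and "\<forall>i. V i = flux_step r U i + r * jump_op U i"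
  then have "l1 (\<lambda>i. V i - 0) \<le> l1 (\<lambda>i. U i - 0)"
    using assms(2) by (intro explicit_contraction[OF CFL]) (auto simp: flux_step_const jump_op_def)
  then show ?thesis by simp
next
  assume CFL: "(F1 + F2) * r \<le> 1" and fin: "l1 V < \<infinity>"
    and V: "\<forall>i. V i = flux_step r U i + r * jump_op V i"
  have "l1 (\<lambda>i. V i - 0) \<le> l1 (\<lambda>i. U i - 0)"
    by (rule implicit_contraction[OF CFL fin V[rule_format]])
      (simp_all add: flux_step_const jump_op_def)
  then show ?thesis by simp
qed

text \<open>Flux step and jump operator commute with the unit shift, so the translate of a step is
  again a step, and the contraction compares the two.\<close>

lemma scheme_step_fdiff:
  assumes "scheme_step U V" "l1 U < \<infinity>"
  shows "l1 (fdiff V) \<le> l1 (fdiff U)"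
proof -
  have flux: "flux_step r X (i + 1) = flux_step r (\<lambda>i. X (i + 1)) i" for i X
    by (simp add: flux_step_def algebra_simps)
  have jump: "jump_op X (i + 1) = jump_op (\<lambda>i. X (i + 1)) i" for i X
    by (simp add: jump_op_def add_ac)
  show ?thesis
    using assms(1)[unfolded scheme_step_def]
  proof (elim disjE conjE)
    assume CFL: "(F1 + F2) * r + r * W \<le> 1" and V: "\<forall>i. V i = flux_step r U i + r * jump_op U i"
    show ?thesis
      unfolding fdiff_def[abs_def]
    proof (rule explicit_contraction[OF CFL])
      show "V (i + 1) = flux_step r (\<lambda>i. U (i + 1)) i + r * jump_op (\<lambda>i. U (i + 1)) i" for i
        by (rule V[rule_format, of "i + 1", unfolded flux jump])
    qed (use assms(2) V in \<open>auto simp: l1_shift\<close>)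
  next
    assume CFL: "(F1 + F2) * r \<le> 1" and fin: "l1 V < \<infinity>"
      and V: "\<forall>i. V i = flux_step r U i + r * jump_op V i"
    show ?thesis
      unfolding fdiff_def[abs_def]
    proof (rule implicit_contraction[OF CFL])
      show "V (i + 1) = flux_step r (\<lambda>i. U (i + 1)) i + r * jump_op (\<lambda>i. V (i + 1)) i" for i
        by (rule V[rule_format, of "i + 1", unfolded flux jump])
      show "V i = flux_step r U i + r * jump_op V i" for i
        by (rule V[rule_format])
    qed (use fin in \<open>auto simp: l1_shift\<close>)
  qed
qed

lemma scheme_step_increment:
  assumes "scheme_step U V" "l1 (jump_op U) \<le> K" "l1 (jump_op V) \<le> K"
  shows "l1 (\<lambda>i. V i - U i) \<le> ennreal r * (ennreal (F1 + F2) * l1 (fdiff U) + K)"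
proof -
  let ?dF = "\<lambda>i. F (U i) (U (i + 1)) - F (U (i - 1)) (U i)"
  \<comment> \<open>\<open>X\<close> is the level on which the jump operator acts: the old one in
    the explicit method, the new one in the implicit-explicit method. Hence the bounds on
    both.\<close>
  obtain X where X: "\<And>i. V i = flux_step r U i + r * jump_op X i" "l1 (jump_op X) \<le> K"
    using assms unfolding scheme_step_def by blast
  have "l1 (\<lambda>i. V i - U i) = l1 (\<lambda>i. r * (jump_op X i - ?dF i))"
    unfolding X flux_step_def by (simp add: algebra_simps)
  also have "\<dots> = ennreal r * l1 (\<lambda>i. jump_op X i - ?dF i)"
    using r_nonneg by (simp add: l1_cmult)
  also have "\<dots> \<le> ennreal r * (l1 (jump_op X) + l1 ?dF)"
    by (intro mult_left_mono l1_triangle_diff) simp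
  also have "\<dots> \<le> ennreal r * (K + ennreal (F1 + F2) * l1 (fdiff U))"
    by (intro mult_left_mono add_mono X l1_flux_difference_le) simp
  finally show ?thesis by (simp add: add.commute)
qed

section \<open>Estimates along a whole sequence of time steps\<close>

context
  fixes U :: "nat \<Rightarrow> int \<Rightarrow> real"
  assumes steps: "\<And>n. scheme_step (U n) (U (Suc n))" and finite_start: "l1 (U 0) < \<infinity>"
begin

lemma scheme_l1: "l1 (U n) \<le> l1 (U 0)"
proof (induction n)
  case (Suc n)
  then have "l1 (U n) < \<infinity>" using finite_start by (rule le_less_trans)
  then show ?case using scheme_step_l1[OF steps] Suc by (metis order_trans)
qed simp

lemma scheme_l1_finite: "l1 (U n) < \<infinity>"
  using scheme_l1 finite_start by (rule le_less_trans)

lemma scheme_fdiff: "l1 (fdiff (U n)) \<le> l1 (fdiff (U 0))"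
proof (induction n)
  case (Suc n)
  then show ?case using scheme_step_fdiff[OF steps scheme_l1_finite] by (metis order_trans)
qed simp

lemma scheme_maximum:
  assumes "\<And>i. \<bar>U 0 i\<bar> \<le> M"
  shows "\<bar>U n i\<bar> \<le> M"
  using assms
proof (induction n arbitrary: i)
  case (Suc n)
  then show ?case using scheme_step_maximum[OF steps] by blast
qed simp

lemma scheme_time_continuity:
  assumes K: "\<And>n. l1 (jump_op (U n)) \<le> K" and "m \<le> n"
  shows "l1 (\<lambda>i. U n i - U m i)
    \<le> of_nat (n - m) * (ennreal r * (ennreal (F1 + F2) * l1 (fdiff (U 0)) + K))"
  using \<open>m \<le> n\<close>
proof (induction n rule: dec_induct)
  case (step n)
  let ?C = "ennreal r * (ennreal (F1 + F2) * l1 (fdiff (U 0)) + K)"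
  have "l1 (\<lambda>i. U (Suc n) i - U m i) \<le> l1 (\<lambda>i. U (Suc n) i - U n i) + l1 (\<lambda>i. U n i - U m i)"
    using l1_triangle[of "\<lambda>i. U (Suc n) i - U n i" "\<lambda>i. U n i - U m i"] by simp
  also have "l1 (\<lambda>i. U (Suc n) i - U n i) \<le> ennreal r * (ennreal (F1 + F2) * l1 (fdiff (U n)) + K)"
    by (rule scheme_step_increment[OF steps K K])
  also have "\<dots> \<le> ?C"
    by (intro mult_left_mono add_mono scheme_fdiff) auto
  also have "?C + l1 (\<lambda>i. U n i - U m i) \<le> ?C + of_nat (n - m) * ?C"
    by (intro add_left_mono step)
  also have "\<dots> = of_nat (Suc n - m) * ?C"
    using step by (simp add: Suc_diff_le algebra_simps)
  finally show ?case by (simp add: add_right_mono)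
qed simp

end

end


section \<open>Hat functions\<close>

text \<open>\<open>hat dx (j - i) z\<close> is the length of the overlap of the \<open>i\<close>-th cell with the \<open>j\<close>-th cell
  translated by \<open>- z\<close>.\<close>

definition hat :: "real \<Rightarrow> int \<Rightarrow> real \<Rightarrow> real" where
  "hat dx k z = max 0 (dx - \<bar>z - of_int k * dx\<bar>)"

lemma hat_nonneg [simp]: "0 \<le> hat dx k z"
  by (simp add: hat_def)

lemma hat_at_zero: "0 < dx \<Longrightarrow> hat dx k 0 = (if k = 0 then dx else 0)"
proof -
  assume "0 < dx"
  have "dx \<le> \<bar>of_int k\<bar> * dx" if "k \<noteq> 0"
  proof -
    have "1 \<le> \<bar>real_of_int k\<bar>" using that by linarith
    from mult_right_mono[OF this, of dx] show ?thesis using \<open>0 < dx\<close> by simp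
  qed
  then show ?thesis using \<open>0 < dx\<close> by (auto simp: hat_def abs_mult)
qed

text \<open>The drop of the central hat is the truncated distance, whose integral against the kernel
  produces the constant of the CFL condition.\<close>

lemma hat_zero: "hat dx 0 z - dx = - min \<bar>z\<bar> dx"
  by (auto simp: hat_def)

lemma borel_measurable_hat [measurable]: "hat dx k \<in> borel_measurable borel"
  unfolding hat_def[abs_def] by measurable

lemma continuous_on_hat: "continuous_on S (hat dx k)"
  unfolding hat_def[abs_def] by (intro continuous_intros)

lemma hat_lipschitz: "\<bar>hat dx k x - hat dx k y\<bar> \<le> \<bar>x - y\<bar>"
  unfolding hat_def by linarith

lemma hat_on_cells:
  assumes "0 < dx" "m * dx \<le> z" "z < (m + 1) * dx" and m: "m = of_int n"
  shows "hat dx k z = (if k = n then (m + 1) * dx - z else if k = n + 1 then z - m * dx else 0)"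
proof -
  consider "k = n" | "k = n + 1" | "k \<le> n - 1" | "n + 2 \<le> k" by linarith
  then show ?thesis
  proof cases
    case 3
    then have "of_int k \<le> m - 1" unfolding m by linarith
    from mult_right_mono[OF this, of dx] show ?thesis
      using 3 assms(1-3) by (auto simp: hat_def algebra_simps)
  next
    case 4
    then have "m + 2 \<le> of_int k" unfolding m by linarith
    from mult_right_mono[OF this, of dx] show ?thesis
      using 4 assms(1-3) by (auto simp: hat_def algebra_simps)
  qed (use assms in \<open>auto simp: hat_def algebra_simps\<close>)
qed

text \<open>Up to the factor \<open>dx\<close> this is piecewise linear interpolation of
  \<open>g\<close>. With \<open>g = 1\<close> it is the partition of unity, with
  \<open>g k = \<bar>k\<bar>\<close> the first absolute moment.\<close>

lemma nn_integral_hat_weighted: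
  assumes "0 < dx" "\<And>k. 0 \<le> g k" "of_int n * dx \<le> z" "z < (of_int n + 1) * dx"
  shows "(\<integral>\<^sup>+k. ennreal (g k * hat dx k z) \<partial>count_space UNIV)
    = ennreal (g n * ((of_int n + 1) * dx - z) + g (n + 1) * (z - of_int n * dx))"
proof -
  have h: "hat dx k z = (if k = n then (of_int n + 1) * dx - z else if k = n + 1 then z - of_int n * dx else 0)" for k
    using hat_on_cells[OF assms(1,3,4)] by simp
  have "(\<integral>\<^sup>+k. ennreal (g k * hat dx k z) \<partial>count_space UNIV) = (\<Sum>k\<in>{n, n + 1}. ennreal (g k * hat dx k z))"
    by (intro nn_integral_count_space') (auto simp: h)
  also have "\<dots> = ennreal (g n * ((of_int n + 1) * dx - z) + g (n + 1) * (z - of_int n * dx))"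
    using assms(2-4) by (simp add: h ennreal_plus)
  finally show ?thesis .
qed

lemma cell_index:
  fixes z dx :: real
  assumes "0 < dx"
  shows "of_int \<lfloor>z / dx\<rfloor> * dx \<le> z" "z < (of_int \<lfloor>z / dx\<rfloor> + 1) * dx"
  using of_int_floor_le[of "z / dx"] real_of_int_floor_add_one_gt[of "z / dx"] assms
  by (simp_all only: pos_le_divide_eq pos_divide_less_eq)

lemma nn_integral_hat:
  assumes "0 < dx"
  shows "(\<integral>\<^sup>+k. ennreal (hat dx k z) \<partial>count_space UNIV) = ennreal dx"
  using nn_integral_hat_weighted[OF assms _ cell_index[OF assms], of "\<lambda>_. 1" z]
  by (simp add: algebra_simps)

lemma nn_integral_hat_abs:
  assumes "0 < dx"
  shows "(\<integral>\<^sup>+k. ennreal (\<bar>of_int k\<bar> * hat dx k z) \<partial>count_space UNIV) = ennreal \<bar>z\<bar>"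
proof -
  define n where "n = \<lfloor>z / dx\<rfloor>"
  have n: "of_int n * dx \<le> z" "z < (of_int n + 1) * dx"
    unfolding n_def by (rule cell_index[OF assms])+
  have "(\<integral>\<^sup>+k. ennreal (\<bar>of_int k\<bar> * hat dx k z) \<partial>count_space UNIV)
    = ennreal (\<bar>of_int n\<bar> * ((of_int n + 1) * dx - z) + \<bar>of_int (n + 1)\<bar> * (z - of_int n * dx))"
    by (rule nn_integral_hat_weighted[OF assms _ n]) simp
  also have "\<bar>of_int n\<bar> * ((of_int n + 1) * dx - z) + \<bar>of_int (n + 1)\<bar> * (z - of_int n * dx) = \<bar>z\<bar>"
  \<comment> \<open>Zero is a grid point, so each cell lies on one side of it; there the absolute
    value is affine and interpolated without error.\<close>
  proof (cases "0 \<le> n")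
    case True
    then have "0 \<le> z" using n(1) assms by (smt (verit) mult_nonneg_nonneg of_int_nonneg)
    then show ?thesis using True by (simp add: algebra_simps)
  next
    case False
    then have "(of_int n + 1) * dx \<le> 0" using assms by (intro mult_nonpos_nonneg) auto
    then have "z < 0" using n(2) by linarith
    then show ?thesis using False by (simp add: algebra_simps)
  qed
  finally show ?thesis .
qed

lemma cell_overlap:
  assumes "0 < dx"
  shows "has_bochner_integral lborel (\<lambda>x. indicator (cell dx i) x * indicator (cell dx j) (x + z)) (hat dx (j - i) z)"
proof -
  let ?a = "max (of_int i * dx) (of_int j * dx - z)"
  let ?b = "min (of_int (i + 1) * dx) (of_int (j + 1) * dx - z)"
  have "(\<lambda>x. indicator (cell dx i) x * indicator (cell dx j) (x + z)) = (indicator {?a<..<?b} :: real \<Rightarrow> real)"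
    by (auto simp: cell_def indicator_def fun_eq_iff algebra_simps)
  moreover have "measure lborel {?a<..<?b} = hat dx (j - i) z"
  proof -
    have "measure lborel {?a<..<?b} = max 0 (?b - ?a)"
      by (cases "?a \<le> ?b") (auto simp: measure_lborel_Ioo)
    also have "\<dots> = hat dx (j - i) z"
      using assms by (auto simp: hat_def algebra_simps max_def min_def)
    finally show ?thesis .
  qed
  moreover have "has_bochner_integral lborel (indicator {?a<..<?b} :: real \<Rightarrow> real) (measure lborel {?a<..<?b})"
  proof (rule has_bochner_integral_real_indicator)
    have "emeasure lborel {?a<..<?b} \<le> emeasure lborel {?a..?b}"
      by (rule emeasure_mono) auto
    also have "\<dots> < \<infinity>" by (simp add: emeasure_lborel_Icc_eq)
    finally show "emeasure lborel {?a<..<?b} < \<infinity>" .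
  qed simp
  ultimately show ?thesis by simp
qed


section \<open>The weights of the discrete operator\<close>

lemma borel_cell [measurable]: "cell dx i \<in> sets borel"
  by (simp add: cell_def)

text \<open>The two integrals in \<open>d_const\<close> are the parts of a single one, split at
  distance 1: inside, \<open>min\<close> cancels one power of the kernel, outside it equals
  1.\<close>

lemma kernel_min_one:
  fixes lam :: real
  assumes lam: "0 < lam" "lam < 1"
  shows "has_bochner_integral lborel (\<lambda>z. min \<bar>z\<bar> 1 / \<bar>z\<bar> powr (1 + lam))
      (d_const lam / c_const lam)"
proof -
  let ?n = "\<lambda>z. indicator {z. \<bar>z\<bar> < 1} z * (1 / \<bar>z\<bar> powr lam)"
  let ?f = "\<lambda>z. indicator {z. \<bar>z\<bar> > 1} z * (1 / \<bar>z\<bar> powr (1 + lam))"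
  let ?p = "\<lambda>z::real. indicator {0..1} z * z powr (- lam)"
  let ?t = "\<lambda>z::real. indicator {1..} z * z powr (- 1 - lam)"
  have "(\<lambda>z::real. z powr (- lam)) absolutely_integrable_on {0..1}"
    using integrable_on_powr_from_0[of "- lam" 1] lam by (intro nonnegative_absolutely_integrable_1) auto
  then have "integrable lebesgue ?p" by (simp add: set_integrable_def)
  then have p: "integrable lborel ?p" by (subst (asm) integrable_completion) auto
  have t: "integrable lborel ?t" using tail_integrable[OF lam(1)] .
  \<comment> \<open>An even function is dominated by its half-line part plus the reflection, written
    as an affine substitution.\<close>
  have "integrable lborel (\<lambda>z. ?p z + ?p (0 + (-1) * z))"
    using p by (intro Bochner_Integration.integrable_add lborel_integrable_real_affine) auto
  then have n: "integrable lborel ?n"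
    by (rule Bochner_Integration.integrable_bound)
      (auto simp: indicator_def powr_minus field_simps)
  have "integrable lborel (\<lambda>z. ?t z + ?t (0 + (-1) * z))"
    using t by (intro Bochner_Integration.integrable_add lborel_integrable_real_affine) auto
  then have f: "integrable lborel ?f"
  proof (rule Bochner_Integration.integrable_bound)
    have "1 / y powr (1 + lam) = y powr (-1 - lam)" for y :: real
      using powr_minus[of y "1 + lam"] by (simp add: field_simps)
    then show "AE z in lborel. norm (?f z) \<le> norm (?t z + ?t (0 + (-1) * z))"
      by (auto simp: indicator_def)
  qed simp
  have d: "d_const lam / c_const lam = integral\<^sup>L lborel ?n + integral\<^sup>L lborel ?f"
    using c_const_pos[OF lam]
    by (simp add: d_const_def set_lebesgue_integral_def integral_completion)
  have "has_bochner_integral lborel (\<lambda>z. ?n z + ?f z) (d_const lam / c_const lam)"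
    unfolding d using n f by (intro has_bochner_integral_add has_bochner_integral_integrable)
  moreover have "AE z in lborel. ?n z + ?f z = min \<bar>z\<bar> 1 / \<bar>z\<bar> powr (1 + lam)"
  proof -
    \<comment> \<open>The strict inequalities in \<open>d_const\<close> omit -1 and 1; away from 0
      the powers can be cancelled.\<close>
    have "AE z in lborel. z \<notin> {-1, 0, 1::real}"
      by (rule AE_not_in) (auto intro!: finite_imp_null_set_lborel)
    then show ?thesis
      by eventually_elim (auto simp: indicator_def powr_add min_def not_less field_simps)
  qed
  ultimately show ?thesis
    by (subst (asm) has_bochner_integral_cong_AE) auto
qed

text \<open>Substitute \<open>z = dx * y\<close>: the truncation scales like \<open>dx\<close>, the
  kernel like \<open>dx powr (- 1 - lam)\<close> and the measure like \<open>dx\<close>.\<close>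

lemma kernel_min_dx:
  fixes lam dx :: real
  assumes lam: "0 < lam" "lam < 1" and dx: "0 < dx"
  shows "has_bochner_integral lborel (\<lambda>z. min \<bar>z\<bar> dx / \<bar>z\<bar> powr (1 + lam))
    (dx powr (1 - lam) * (d_const lam / c_const lam))"
proof -
  let ?K = "\<lambda>z. min \<bar>z\<bar> 1 / \<bar>z\<bar> powr (1 + lam)"
  have K: "integrable lborel ?K" "integral\<^sup>L lborel ?K = d_const lam / c_const lam"
    using kernel_min_one[OF lam] by (auto simp: has_bochner_integral_iff)
  have scale: "min \<bar>z\<bar> dx / \<bar>z\<bar> powr (1 + lam) = dx powr (- lam) * ?K (0 + (1 / dx) * z)" for z
  proof -
    have "min \<bar>z\<bar> dx = dx * min \<bar>z / dx\<bar> 1"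
      using dx by (auto simp: min_def field_simps)
    moreover have "\<bar>z\<bar> powr (1 + lam) = dx powr (1 + lam) * \<bar>z / dx\<bar> powr (1 + lam)"
      using dx by (simp add: abs_divide powr_divide)
    moreover have "dx / dx powr (1 + lam) = dx powr (- lam)"
      using dx by (simp add: powr_add powr_minus field_simps)
    ultimately show ?thesis by (simp add: times_divide_times_eq[symmetric])
  qed
  have "integral\<^sup>L lborel ?K = \<bar>1 / dx\<bar> *\<^sub>R (LINT z|lborel. ?K (0 + (1 / dx) * z))"
    using dx by (intro lborel_integral_real_affine) auto
  then have "(LINT z|lborel. ?K (0 + (1 / dx) * z)) = dx * (d_const lam / c_const lam)"
    using dx K(2) by (simp add: field_simps)
  moreover have "dx powr (- lam) * dx = dx powr (1 - lam)"
    using dx by (simp add: powr_diff powr_minus field_simps)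
  moreover have "integrable lborel (\<lambda>z. ?K (0 + (1 / dx) * z))"
    using K(1) dx by (intro lborel_integrable_real_affine) auto
  ultimately have "has_bochner_integral lborel (\<lambda>z. dx powr (- lam) * ?K (0 + (1 / dx) * z))
      (dx powr (- lam) * (dx * (d_const lam / c_const lam)))"
    by (intro has_bochner_integral_mult_right) (simp add: has_bochner_integral_iff)
  then show ?thesis
    unfolding scale \<open>dx powr (- lam) * dx = dx powr (1 - lam)\<close>[symmetric] by (simp only: mult.assoc)
qed

lemma d_const_nonneg:
  assumes "0 < lam" "lam < 1"
  shows "0 \<le> d_const lam"
proof -
  have "0 \<le> d_const lam / c_const lam"
    using has_bochner_integral_integral_eq[OF kernel_min_one[OF assms]]
    by (metis (no_types, lifting) Bochner_Integration.integral_nonneg abs_ge_zero divide_nonneg_nonneg min_def powr_ge_zero zero_le_one)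
  then show ?thesis using c_const_pos[OF assms] by (simp add: zero_le_divide_iff)
qed

section \<open>Identification of the weights by Fubini\<close>

lemma frac_lap_cell:
  "frac_lap lam (indicator (cell dx j)) x = c_const lam *
     (LINT z|lborel. (indicator (cell dx j) (x + z) - indicator (cell dx j) x) / \<bar>z\<bar> powr (1 + lam))"
proof -
  have "(LINT z:{z. \<bar>z\<bar> > 0}|lebesgue. (indicator (cell dx j) (x + z) - indicator (cell dx j) x) / \<bar>z\<bar> powr (1 + lam))
      = (LINT z|lebesgue. (indicator (cell dx j) (x + z) - indicator (cell dx j) x) / \<bar>z\<bar> powr (1 + lam) :: real)"
    \<comment> \<open>The increment vanishes at \<open>z = 0\<close>, so restricting to nonzero
      \<open>z\<close> changes nothing.\<close>
    unfolding set_lebesgue_integral_def by (intro Bochner_Integration.integral_cong) (auto simp: indicator_def)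
  then show ?thesis
    unfolding frac_lap_def by (simp add: integral_completion)
qed

text \<open>This is \<open>G_weight lam dx i j\<close> with \<open>k = j - i\<close> after
  integrating in \<open>x\<close> first: the overlap of the cells turns indicators into
  hats.\<close>

definition jump_weight :: "real \<Rightarrow> real \<Rightarrow> int \<Rightarrow> real" where
  "jump_weight lam dx k = c_const lam * (LINT z|lborel. (hat dx k z - hat dx k 0) / \<bar>z\<bar> powr (1 + lam))"

text \<open>Makes the weights converge: the linear bound tames the singularity at the origin because
  \<open>lam < 1\<close>, the constant bound serves the tail.\<close>

lemma hat_increment_bound:
  assumes "0 < dx"
  shows "\<bar>hat dx k z - hat dx k 0\<bar> \<le> min \<bar>z\<bar> dx"
  using hat_lipschitz[of dx k z 0] assms
  by (auto simp: hat_at_zero[OF assms] hat_zero) (auto simp: hat_def)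

lemma hat_increment_nonneg: "0 < dx \<Longrightarrow> k \<noteq> 0 \<Longrightarrow> 0 \<le> hat dx k z - hat dx k 0"
  by (simp add: hat_at_zero)

lemma jump_weight_integrable:
  assumes "0 < lam" "lam < 1" "0 < dx"
  shows "integrable lborel (\<lambda>z. (hat dx k z - hat dx k 0) / \<bar>z\<bar> powr (1 + lam))"
proof (rule Bochner_Integration.integrable_bound)
  show "integrable lborel (\<lambda>z. min \<bar>z\<bar> dx / \<bar>z\<bar> powr (1 + lam))"
    using kernel_min_dx[OF assms] by (simp add: has_bochner_integral_iff)
  show "AE z in lborel. norm ((hat dx k z - hat dx k 0) / \<bar>z\<bar> powr (1 + lam))
      \<le> norm (min \<bar>z\<bar> dx / \<bar>z\<bar> powr (1 + lam))"
    using hat_increment_bound[OF assms(3), of k] assms(3) by (auto intro!: divide_right_mono)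
qed simp

text \<open>Exchange the integrals in \<open>x\<close> and \<open>z\<close>; for fixed
  \<open>z\<close> the inner integral is an increment of the overlap length. Integrability on the
  product comes from the sign of the integrand.\<close>

lemma G_weight_eq:
  assumes lam: "0 < lam" "lam < 1" and dx: "0 < dx"
  shows "G_weight lam dx i j = jump_weight lam dx (j - i)"
proof -
  define h where "h z x = indicator (cell dx i) x *
    (indicator (cell dx j) (x + z) - indicator (cell dx j) x) / \<bar>z\<bar> powr (1 + lam)" for x z :: real
  have h_meas[measurable]: "case_prod h \<in> borel_measurable (lborel \<Otimes>\<^sub>M lborel)"
    unfolding h_def by measurable
  have inner: "has_bochner_integral lborel (h z) ((hat dx (j - i) z - hat dx (j - i) 0) / \<bar>z\<bar> powr (1 + lam))" for z
  proof -
    have "has_bochner_integral lborel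
      (\<lambda>x. (indicator (cell dx i) x * indicator (cell dx j) (x + z)
        - indicator (cell dx i) x * indicator (cell dx j) (x + 0)) / \<bar>z\<bar> powr (1 + lam))
      ((hat dx (j - i) z - hat dx (j - i) 0) / \<bar>z\<bar> powr (1 + lam))"
      by (intro has_bochner_integral_divide_zero has_bochner_integral_diff cell_overlap dx)
    then show ?thesis by (simp add: h_def[abs_def] right_diff_distrib)
  qed
  \<comment> \<open>For \<open>i = j\<close> the increment is nonpositive on the cell, and for
    disjoint cells it is nonnegative. The norm is therefore \<open>\<sigma>\<close> times the
    integrand, and its integral is known from \<open>inner\<close>.\<close>
  define \<sigma> where "\<sigma> = (if i = j then -1 else 1 :: real)"
  have disj: "x \<notin> cell dx j" if "x \<in> cell dx i" "i \<noteq> j" for x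
  proof
    assume "x \<in> cell dx j"
    with that dx have "of_int i < real_of_int (j + 1)" "of_int j < real_of_int (i + 1)"
      unfolding cell_def by (auto simp: intro: mult_less_cancel_right_pos[THEN iffD1, OF dx] less_trans)
    with \<open>i \<noteq> j\<close> show False by linarith
  qed
  have norm_h: "norm (h z x) = \<sigma> * h z x" for z x
    using disj[of x] by (auto simp: h_def \<sigma>_def indicator_def)
  have int: "integrable (lborel \<Otimes>\<^sub>M lborel) (case_prod h)"
  proof (rule lborel_pair.Fubini_integrable)
    show "integrable lborel (\<lambda>z. \<integral>x. norm (case (z, x) of (z, x) \<Rightarrow> h z x) \<partial>lborel)"
      using integrable_mult_right[OF jump_weight_integrable[OF lam dx, of "j - i"], of \<sigma>]
        has_bochner_integral_integral_eq[OF inner]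
      by (simp add: norm_h del: real_norm_def integrable_mult_right_iff)
    show "AE z in lborel. integrable lborel (\<lambda>x. case (z, x) of (z, x) \<Rightarrow> h z x)"
      using inner by (auto simp: has_bochner_integral_iff)
  qed simp
  have "G_weight lam dx i j = (LINT x|lborel. c_const lam * (LINT z|lborel. h z x))"
  proof -
    have "G_weight lam dx i j = (LINT x|lebesgue. c_const lam * (LINT z|lborel. h z x))"
      unfolding G_weight_def frac_lap_cell set_lebesgue_integral_def
      by (intro Bochner_Integration.integral_cong) (auto simp: h_def indicator_def)
    also have "\<dots> = (LINT x|lborel. c_const lam * (LINT z|lborel. h z x))"
      by (intro integral_completion) (unfold h_def, measurable)
    finally show ?thesis .
  qed
  also have "\<dots> = c_const lam * (LINT x|lborel. LINT z|lborel. h z x)"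
    by simp
  also have "(LINT x|lborel. LINT z|lborel. h z x) = (LINT z|lborel. LINT x|lborel. h z x)"
    by (rule lborel_pair.Fubini_integral[OF int])
  also have "\<dots> = (LINT z|lborel. (hat dx (j - i) z - hat dx (j - i) 0) / \<bar>z\<bar> powr (1 + lam))"
    using has_bochner_integral_integral_eq[OF inner] by simp
  finally show ?thesis unfolding jump_weight_def .
qed

lemma jump_weight_zero:
  assumes lam: "0 < lam" "lam < 1" and dx: "0 < dx"
  shows "jump_weight lam dx 0 = - (d_const lam * dx powr (1 - lam))"
proof -
  have "(LINT z|lborel. (hat dx 0 z - hat dx 0 0) / \<bar>z\<bar> powr (1 + lam))
      = (LINT z|lborel. - (min \<bar>z\<bar> dx / \<bar>z\<bar> powr (1 + lam)))"
    using dx by (simp add: hat_at_zero hat_zero)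
  also have "\<dots> = - (dx powr (1 - lam) * (d_const lam / c_const lam))"
    using has_bochner_integral_integral_eq[OF kernel_min_dx[OF assms]] by simp
  finally show ?thesis
    unfolding jump_weight_def using c_const_pos[OF lam] by simp
qed

text \<open>By the partition of unity the other hats gain exactly what the central one loses between
  0 and \<open>z\<close>. Its negative increment is truncated by \<open>ennreal\<close>; the proof
  adds the central hat back as \<open>?d\<close> and cancels it.\<close>

lemma nn_integral_hat_increment:
  assumes dx: "0 < dx"
  shows "(\<integral>\<^sup>+k. ennreal (hat dx k z - hat dx k 0) \<partial>count_space UNIV) = ennreal (min \<bar>z\<bar> dx)"
proof -
  let ?h = "\<integral>\<^sup>+k. ennreal (hat dx k z - hat dx k 0) \<partial>count_space UNIV"
  let ?d = "\<lambda>k::int. if k = 0 then ennreal (hat dx 0 z) else 0"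
  have d: "(\<integral>\<^sup>+k. ?d k \<partial>count_space UNIV) = ennreal (hat dx 0 z)"
    by (subst nn_integral_count_space'[where A = "{0}"]) auto
  have "ennreal (hat dx k z) = ennreal (hat dx k z - hat dx k 0) + ?d k" for k
    using hat_zero[of dx z] dx by (auto simp: hat_at_zero ennreal_neg)
  then have "(\<integral>\<^sup>+k. ennreal (hat dx k z) \<partial>count_space UNIV)
      = (\<integral>\<^sup>+k. ennreal (hat dx k z - hat dx k 0) + ?d k \<partial>count_space UNIV)"
    by (intro nn_integral_cong)
  then have "ennreal dx = ?h + ennreal (hat dx 0 z)"
    unfolding nn_integral_hat[OF dx] using d by (simp add: nn_integral_add)
  also have "ennreal dx = ennreal (min \<bar>z\<bar> dx) + ennreal (hat dx 0 z)"
    using hat_zero[of dx z] dx by (simp flip: ennreal_plus)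
  finally have "ennreal (hat dx 0 z) + ?h = ennreal (hat dx 0 z) + ennreal (min \<bar>z\<bar> dx)"
    by (simp only: add.commute)
  then show ?thesis
    by (simp only: ennreal_add_left_cancel) simp
qed

text \<open>A nonnegative form of the weights, fit for Tonelli. At \<open>k = 0\<close> both sides
  are truncated to 0.\<close>

lemma ennreal_jump_weight:
  assumes lam: "0 < lam" "lam < 1" and dx: "0 < dx"
  shows "ennreal (jump_weight lam dx k)
    = (\<integral>\<^sup>+z. ennreal (c_const lam / \<bar>z\<bar> powr (1 + lam)) * ennreal (hat dx k z - hat dx k 0) \<partial>lborel)"
proof (cases "k = 0")
  case True
  have "hat dx 0 z - hat dx 0 0 \<le> 0" for z
    using hat_zero[of dx z] dx by (simp add: hat_at_zero)
  moreover have "jump_weight lam dx 0 \<le> 0"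
    using jump_weight_zero[OF assms] d_const_nonneg[OF lam] by simp
  ultimately show ?thesis
    using True by (simp add: ennreal_neg)
next
  case False
  let ?g = "\<lambda>z. c_const lam * ((hat dx k z - hat dx k 0) / \<bar>z\<bar> powr (1 + lam))"
  have "ennreal (integral\<^sup>L lborel ?g) = (\<integral>\<^sup>+z. ennreal (?g z) \<partial>lborel)"
    using jump_weight_integrable[OF lam dx, of k] hat_increment_nonneg[OF dx False] c_const_pos[OF lam]
    by (intro nn_integral_eq_integral[symmetric] integrable_mult_right) auto
  also have "\<dots> = (\<integral>\<^sup>+z. ennreal (c_const lam / \<bar>z\<bar> powr (1 + lam)) * ennreal (hat dx k z - hat dx k 0) \<partial>lborel)"
    using hat_increment_nonneg[OF dx False] c_const_pos[OF lam]
    by (intro nn_integral_cong) (simp flip: ennreal_mult)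
  finally show ?thesis
    unfolding jump_weight_def by (simp only: integral_mult_right_zero)
qed

text \<open>The multiplier \<open>m\<close> serves two purposes: constant 1 yields the total rate,
  norms of shift differences yield the bound on the jump operator.\<close>

lemma nn_integral_jump_weight:
  assumes lam: "0 < lam" "lam < 1" and dx: "0 < dx"
  shows "(\<integral>\<^sup>+k. ennreal (jump_weight lam dx k) * m k \<partial>count_space UNIV)
    = (\<integral>\<^sup>+z. ennreal (c_const lam / \<bar>z\<bar> powr (1 + lam)) *
        (\<integral>\<^sup>+k. ennreal (hat dx k z - hat dx k 0) * m k \<partial>count_space UNIV) \<partial>lborel)"
proof -
  have "(\<integral>\<^sup>+k. ennreal (jump_weight lam dx k) * m k \<partial>count_space UNIV)
      = (\<integral>\<^sup>+k. \<integral>\<^sup>+z. ennreal (c_const lam / \<bar>z\<bar> powr (1 + lam)) * (ennreal (hat dx k z - hat dx k 0) * m k)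
          \<partial>lborel \<partial>count_space UNIV)"
    unfolding ennreal_jump_weight[OF assms] by (simp add: nn_integral_multc[symmetric] mult.assoc)
  also have "\<dots> = (\<integral>\<^sup>+z. \<integral>\<^sup>+k. ennreal (c_const lam / \<bar>z\<bar> powr (1 + lam)) * (ennreal (hat dx k z - hat dx k 0) * m k)
          \<partial>count_space UNIV \<partial>lborel)"
    by (rule nn_integral_count_space_nn_integral[symmetric]) auto
  finally show ?thesis by (simp add: nn_integral_cmult)
qed

lemma nn_integral_kernel_min:
  assumes lam: "0 < lam" "lam < 1" and dx: "0 < dx"
  shows "(\<integral>\<^sup>+z. ennreal (c_const lam / \<bar>z\<bar> powr (1 + lam)) * ennreal (min \<bar>z\<bar> dx) \<partial>lborel)
    = ennreal (d_const lam * dx powr (1 - lam))"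
proof -
  let ?K = "\<lambda>z. min \<bar>z\<bar> dx / \<bar>z\<bar> powr (1 + lam)"
  have "(\<integral>\<^sup>+z. ennreal (c_const lam / \<bar>z\<bar> powr (1 + lam)) * ennreal (min \<bar>z\<bar> dx) \<partial>lborel)
      = (\<integral>\<^sup>+z. ennreal (c_const lam * ?K z) \<partial>lborel)"
    using c_const_pos[OF lam] dx by (intro nn_integral_cong) (simp flip: ennreal_mult)
  also have "\<dots> = ennreal (LINT z|lborel. c_const lam * ?K z)"
    using kernel_min_dx[OF assms] c_const_pos[OF lam] dx
    by (intro nn_integral_eq_integral integrable_mult_right) (auto simp: has_bochner_integral_iff)
  also have "(LINT z|lborel. c_const lam * ?K z) = c_const lam * (LINT z|lborel. ?K z)"
    by (rule integral_mult_right_zero)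
  also have "\<dots> = d_const lam * dx powr (1 - lam)"
    using has_bochner_integral_integral_eq[OF kernel_min_dx[OF assms]] c_const_pos[OF lam] by simp
  finally show ?thesis .
qed

lemma jump_weights_jump_weight:
  assumes lam: "0 < lam" "lam < 1" and dx: "0 < dx"
  shows "jump_weights (jump_weight lam dx) (d_const lam * dx powr (1 - lam))"
proof
  show "0 \<le> d_const lam * dx powr (1 - lam)"
    using d_const_nonneg[OF lam] by simp
  show "jump_weight lam dx 0 = - (d_const lam * dx powr (1 - lam))"
    by (rule jump_weight_zero[OF assms])
  show "0 \<le> jump_weight lam dx k" if "k \<noteq> 0" for k
    unfolding jump_weight_def using c_const_pos[OF lam] hat_increment_nonneg[OF dx that]
    by (intro mult_nonneg_nonneg Bochner_Integration.integral_nonneg divide_nonneg_nonneg) auto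
  show "(\<integral>\<^sup>+k. ennreal (jump_weight lam dx k) \<partial>count_space UNIV) = ennreal (d_const lam * dx powr (1 - lam))"
    using nn_integral_jump_weight[OF assms, of "\<lambda>_. 1"] nn_integral_kernel_min[OF assms]
    by (simp add: nn_integral_hat_increment[OF dx])
qed

text \<open>Split at distance 1, whatever the grid. For short jumps the first bound and the
  interpolation of \<open>\<bar>k\<bar>\<close> give \<open>\<bar>z\<bar> * T\<close>; for long ones
  the second bound and the partition of unity give \<open>dx * S\<close>. Integrating
  \<open>min \<bar>z\<bar> 1\<close> against the kernel leaves \<open>d_const lam\<close>.\<close>

lemma jump_weight_moment:
  assumes lam: "0 < lam" "lam < 1" and dx: "0 < dx"
    and m: "\<And>k. m k \<le> ennreal \<bar>of_int k\<bar> * T" "\<And>k. m k \<le> S"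
  shows "(\<integral>\<^sup>+k. ennreal (jump_weight lam dx k) * m k \<partial>count_space UNIV)
    \<le> ennreal (d_const lam) * (T + ennreal dx * S)"
proof -
  have inner: "(\<integral>\<^sup>+k. ennreal (hat dx k z - hat dx k 0) * m k \<partial>count_space UNIV)
      \<le> ennreal (min \<bar>z\<bar> 1) * (T + ennreal dx * S)" (is "?I \<le> _") for z
  proof (cases "\<bar>z\<bar> \<le> 1")
    case True
    have "?I \<le> (\<integral>\<^sup>+k. ennreal (\<bar>of_int k\<bar> * hat dx k z) * T \<partial>count_space UNIV)"
    proof (rule nn_integral_mono)
      fix k
      have "ennreal (hat dx k z - hat dx k 0) * m k \<le> ennreal (hat dx k z) * (ennreal \<bar>of_int k\<bar> * T)"
        by (intro mult_mono m ennreal_leI) auto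
      then show "ennreal (hat dx k z - hat dx k 0) * m k \<le> ennreal (\<bar>of_int k\<bar> * hat dx k z) * T"
        by (simp add: ennreal_mult mult_ac)
    qed
    also have "\<dots> = ennreal \<bar>z\<bar> * T"
      by (simp add: nn_integral_multc nn_integral_hat_abs[OF dx])
    also have "\<dots> \<le> ennreal (min \<bar>z\<bar> 1) * (T + ennreal dx * S)"
      using True by (intro mult_mono) auto
    finally show ?thesis .
  next
    case False
    have "?I \<le> (\<integral>\<^sup>+k. ennreal (hat dx k z) * S \<partial>count_space UNIV)"
      by (intro nn_integral_mono mult_mono m ennreal_leI) auto
    also have "\<dots> = ennreal dx * S"
      by (simp add: nn_integral_multc nn_integral_hat[OF dx])
    also have "\<dots> \<le> ennreal (min \<bar>z\<bar> 1) * (T + ennreal dx * S)"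
      using False by simp
    finally show ?thesis .
  qed
  have "(\<integral>\<^sup>+k. ennreal (jump_weight lam dx k) * m k \<partial>count_space UNIV)
      \<le> (\<integral>\<^sup>+z. ennreal (c_const lam / \<bar>z\<bar> powr (1 + lam)) * (ennreal (min \<bar>z\<bar> 1) * (T + ennreal dx * S)) \<partial>lborel)"
    unfolding nn_integral_jump_weight[OF lam dx] by (intro nn_integral_mono mult_left_mono inner) simp
  also have "\<dots> = ennreal (d_const lam) * (T + ennreal dx * S)"
    using nn_integral_kernel_min[OF lam, of 1] by (simp add: mult.assoc[symmetric] nn_integral_multc)
  finally show ?thesis .
qed


section \<open>Grid functions and cell averages\<close>

lemma sum_le_l1: "finite A \<Longrightarrow> ennreal (\<Sum>i\<in>A. \<bar>U i\<bar>) \<le> l1 U"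
proof -
  assume "finite A"
  then have "ennreal (\<Sum>i\<in>A. \<bar>U i\<bar>) = (\<integral>\<^sup>+i. ennreal \<bar>U i\<bar> \<partial>count_space A)"
    by (simp add: nn_integral_count_space_finite sum_ennreal)
  also have "\<dots> \<le> l1 U"
    unfolding l1_def by (subst nn_integral_count_space_indicator) (auto intro!: nn_integral_mono simp: indicator_def)
  finally show ?thesis .
qed

lemma l1_le_if_finite_sums_le:
  assumes "\<And>A. finite A \<Longrightarrow> (\<Sum>i\<in>A. \<bar>U i\<bar>) \<le> T"
  shows "l1 U \<le> ennreal T"
proof -
  let ?f = "\<lambda>n i. ennreal \<bar>U i\<bar> * indicator {- int n..int n} i"
  have "l1 U = (\<integral>\<^sup>+i. (SUP n. ?f n i) \<partial>count_space UNIV)"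
    unfolding l1_def
  proof (intro nn_integral_cong antisym)
    fix i
    have "ennreal \<bar>U i\<bar> = ?f (nat \<bar>i\<bar>) i" by (auto simp: indicator_def)
    also have "\<dots> \<le> (SUP n. ?f n i)" by (rule SUP_upper) simp
    finally show "ennreal \<bar>U i\<bar> \<le> (SUP n. ?f n i)" .
    show "(SUP n. ?f n i) \<le> ennreal \<bar>U i\<bar>"
      by (rule SUP_least) (auto simp: indicator_def)
  qed
  also have "\<dots> = (SUP n. \<integral>\<^sup>+i. ?f n i \<partial>count_space UNIV)"
    by (rule nn_integral_monotone_convergence_SUP) (auto simp: incseq_def le_fun_def indicator_def)
  also have "\<dots> \<le> ennreal T"
  proof (rule SUP_least)
    fix n
    have "(\<integral>\<^sup>+i. ?f n i \<partial>count_space UNIV) = ennreal (\<Sum>i\<in>{- int n..int n}. \<bar>U i\<bar>)"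
      by (subst nn_integral_count_space_indicator[symmetric]) (simp_all add: nn_integral_count_space_finite sum_ennreal)
    also have "\<dots> \<le> ennreal T" by (intro ennreal_leI assms) simp
    finally show "(\<integral>\<^sup>+i. ?f n i \<partial>count_space UNIV) \<le> ennreal T" .
  qed
  finally show ?thesis .
qed

section \<open>Norms of piecewise constant functions\<close>

lemma borel_measurable_step [measurable]:
  fixes U :: "int \<Rightarrow> real"
  shows "(\<lambda>x::real. U \<lfloor>x / dx\<rfloor>) \<in> borel_measurable borel"
proof -
  have "(\<lambda>x::real. \<lfloor>x / dx\<rfloor>) \<in> measurable borel (count_space UNIV)" by measurable
  from measurable_compose[OF this, of U borel] show ?thesis by simp
qed

lemma floor_eq_iff_grid:
  fixes x dx :: real
  assumes "0 < dx"
  shows "\<lfloor>x / dx\<rfloor> = i \<longleftrightarrow> x \<in> {of_int i * dx..<of_int (i + 1) * dx}"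
  using assms by (auto simp: floor_eq_iff pos_le_divide_eq pos_divide_less_eq)

lemma L1_norm_step:
  assumes "0 < dx"
  shows "L1_norm (\<lambda>x. U \<lfloor>x / dx\<rfloor>) = ennreal dx * l1 U"
proof -
  let ?I = "\<lambda>i. {of_int i * dx..<of_int (i + 1) * dx}"
  have "L1_norm (\<lambda>x. U \<lfloor>x / dx\<rfloor>) = (\<integral>\<^sup>+x. ennreal \<bar>U \<lfloor>x / dx\<rfloor>\<bar> \<partial>lborel)"
    unfolding L1_norm_def by (rule nn_integral_completion)
  also have "\<dots> = (\<integral>\<^sup>+x. \<integral>\<^sup>+i. ennreal \<bar>U i\<bar> * indicator (?I i) x \<partial>count_space UNIV \<partial>lborel)"
  proof (rule nn_integral_cong)
    fix x
    have ind: "indicator (?I i) x = (if i = \<lfloor>x / dx\<rfloor> then 1 else 0 :: ennreal)" for i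
      using floor_eq_iff_grid[OF assms, of x i] by (auto simp: indicator_def)
    have "(\<integral>\<^sup>+i. ennreal \<bar>U i\<bar> * indicator (?I i) x \<partial>count_space UNIV)
      = (\<Sum>i\<in>{\<lfloor>x / dx\<rfloor>}. ennreal \<bar>U i\<bar> * indicator (?I i) x)"
      unfolding ind by (intro nn_integral_count_space') (auto split: if_splits)
    then show "ennreal \<bar>U \<lfloor>x / dx\<rfloor>\<bar> = (\<integral>\<^sup>+i. ennreal \<bar>U i\<bar> * indicator (?I i) x \<partial>count_space UNIV)"
      unfolding ind by simp
  qed
  also have "\<dots> = (\<integral>\<^sup>+i. \<integral>\<^sup>+x. ennreal \<bar>U i\<bar> * indicator (?I i) x \<partial>lborel \<partial>count_space UNIV)"
    by (rule nn_integral_count_space_nn_integral) auto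
  also have "\<dots> = (\<integral>\<^sup>+i. ennreal dx * ennreal \<bar>U i\<bar> \<partial>count_space UNIV)"
  proof (rule nn_integral_cong)
    fix i
    have "of_int i * dx \<le> of_int (i + 1) * dx" using assms by (intro mult_right_mono) auto
    then have "emeasure lborel (?I i) = ennreal dx" by (simp add: algebra_simps)
    then show "(\<integral>\<^sup>+x. ennreal \<bar>U i\<bar> * indicator (?I i) x \<partial>lborel) = ennreal dx * ennreal \<bar>U i\<bar>"
      by (simp add: nn_integral_cmult_indicator mult.commute)
  qed
  finally show ?thesis by (simp add: l1_def nn_integral_cmult)
qed

lemma Linf_norm_step_le:
  assumes "\<And>i. \<bar>U i\<bar> \<le> M"
  shows "Linf_norm (\<lambda>x. U \<lfloor>x / dx\<rfloor>) \<le> ennreal M"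
  unfolding Linf_norm_def
proof (rule esssup_I)
  show "(\<lambda>x. ennreal \<bar>U \<lfloor>x / dx\<rfloor>\<bar>) \<in> borel_measurable lebesgue"
    by (rule measurable_completion) measurable
qed (use assms in \<open>auto intro: ennreal_leI\<close>)

section \<open>Bounds for cell averages\<close>

lemma cell_imp_floor_eq:
  assumes "0 < dx" "x \<in> cell dx i"
  shows "i = \<lfloor>x / dx\<rfloor>"
  using assms(2) by (subst eq_commute, subst floor_eq_iff_grid[OF assms(1)]) (auto simp: cell_def)

lemma cell_sets_lebesgue [simp]: "cell dx i \<in> sets lebesgue"
  unfolding cell_def by simp

lemma integrable_on_cell:
  assumes "integrable lebesgue u"
  shows "integrable lebesgue (\<lambda>x. indicator (cell dx i) x * u x :: real)"
  using integrable_mult_indicator[OF cell_sets_lebesgue assms] by simp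

text \<open>Triangle inequality in each cell, then Tonelli and disjointness. Grid points lie in no
  open cell, so the last pointwise comparison is only an inequality.\<close>

lemma l1_cell_average_le:
  assumes "0 < dx" and u: "integrable lebesgue u"
  shows "ennreal dx * l1 (cell_average dx u) \<le> L1_norm u"
proof -
  have [measurable]: "u \<in> borel_measurable lebesgue" using u by simp
  have meas: "(\<lambda>x. ennreal \<bar>indicator (cell dx i) x * u x\<bar>) \<in> borel_measurable lebesgue" for i
    using integrable_on_cell[OF u, of dx i] by measurable
  have "ennreal dx * l1 (cell_average dx u) = l1 (\<lambda>i. dx * cell_average dx u i)"
    using assms by (simp add: l1_cmult)
  also have "\<dots> \<le> (\<integral>\<^sup>+i. \<integral>\<^sup>+x. ennreal \<bar>indicator (cell dx i) x * u x\<bar> \<partial>lebesgue \<partial>count_space UNIV)"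
    unfolding l1_def
  proof (rule nn_integral_mono)
    fix i
    have "\<bar>dx * cell_average dx u i\<bar> = norm (LINT x|lebesgue. indicator (cell dx i) x * u x)"
      using assms by (simp add: cell_average_def set_lebesgue_integral_def)
    also have "\<dots> \<le> (LINT x|lebesgue. norm (indicator (cell dx i) x * u x))"
      by (rule integral_norm_bound)
    finally have "ennreal \<bar>dx * cell_average dx u i\<bar> \<le> ennreal (LINT x|lebesgue. norm (indicator (cell dx i) x * u x))"
      by (rule ennreal_leI)
    also have "\<dots> = (\<integral>\<^sup>+x. ennreal (norm (indicator (cell dx i) x * u x)) \<partial>lebesgue)"
      using integrable_on_cell[OF u] by (intro nn_integral_eq_integral[symmetric] integrable_norm) auto
    finally show "ennreal \<bar>dx * cell_average dx u i\<bar> \<le> (\<integral>\<^sup>+x. ennreal \<bar>indicator (cell dx i) x * u x\<bar> \<partial>lebesgue)"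
      by simp
  qed
  also have "\<dots> = (\<integral>\<^sup>+x. \<integral>\<^sup>+i. ennreal \<bar>indicator (cell dx i) x * u x\<bar> \<partial>count_space UNIV \<partial>lebesgue)"
    by (rule nn_integral_count_space_nn_integral[symmetric]) (use meas in auto)
  also have "\<dots> \<le> L1_norm u"
    unfolding L1_norm_def
  proof (rule nn_integral_mono)
    fix x
    have "(\<integral>\<^sup>+i. ennreal \<bar>indicator (cell dx i) x * u x\<bar> \<partial>count_space UNIV)
      = (\<Sum>i\<in>{\<lfloor>x / dx\<rfloor>}. ennreal \<bar>indicator (cell dx i) x * u x\<bar>)"
      using cell_imp_floor_eq[OF assms(1)] by (intro nn_integral_count_space') (auto simp: indicator_def)
    also have "\<dots> \<le> ennreal \<bar>u x\<bar>" by (simp add: indicator_def)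
    finally show "(\<integral>\<^sup>+i. ennreal \<bar>indicator (cell dx i) x * u x\<bar> \<partial>count_space UNIV) \<le> ennreal \<bar>u x\<bar>" .
  qed
  finally show ?thesis .
qed

lemma cell_average_le:
  assumes dx: "0 < dx" and u: "integrable lebesgue u" and M: "AE x in lebesgue. \<bar>u x\<bar> \<le> M"
  shows "\<bar>cell_average dx u i\<bar> \<le> M"
proof -
  have le: "of_int i * dx \<le> of_int (i + 1) * dx" using dx by (intro mult_right_mono) auto
  have meas: "measure lebesgue (cell dx i) = dx"
    using le by (simp add: cell_def algebra_simps)
  have fin: "emeasure lebesgue (cell dx i) < \<infinity>"
    using le by (simp add: cell_def)
  have "\<bar>LINT x|lebesgue. indicator (cell dx i) x * u x\<bar> \<le> (LINT x|lebesgue. norm (indicator (cell dx i) x * u x))"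
    using integral_norm_bound[of lebesgue "\<lambda>x. indicator (cell dx i) x * u x"] by simp
  also have "\<dots> \<le> (LINT x|lebesgue. indicator (cell dx i) x * M)"
  proof (rule integral_mono_AE)
    show "integrable lebesgue (\<lambda>x. norm (indicator (cell dx i) x * u x))"
      using integrable_on_cell[OF u] by (rule integrable_norm)
    show "integrable lebesgue (\<lambda>x. indicator (cell dx i) x * M)"
      using fin by (intro integrable_mult_left) (simp add: integrable_indicator_iff)
    show "AE x in lebesgue. norm (indicator (cell dx i) x * u x) \<le> indicator (cell dx i) x * M"
      using M by eventually_elim (auto simp: indicator_def)
  qed
  also have "\<dots> = dx * M"
    by (simp add: meas)
  finally show ?thesis
    using dx by (simp add: cell_average_def set_lebesgue_integral_def field_simps abs_mult)
qed


section \<open>Total variation of grid functions\<close>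

lemma BV_test_functionE:
  assumes "\<phi> \<in> BV_test_functions"
  obtains R where "\<And>x. (\<phi> has_real_derivative deriv \<phi> x) (at x)" "continuous_on UNIV (deriv \<phi>)"
    "\<And>x. R < \<bar>x\<bar> \<Longrightarrow> \<phi> x = 0" "\<And>x. R < \<bar>x\<bar> \<Longrightarrow> deriv \<phi> x = 0" "\<And>x. \<bar>\<phi> x\<bar> \<le> 1"
proof -
  have C1: "\<phi> C1_differentiable_on UNIV" and cpt: "compact (closure {x. \<phi> x \<noteq> 0})"
    and le: "\<And>x. \<bar>\<phi> x\<bar> \<le> 1"
    using assms by (auto simp: BV_test_functions_def)
  obtain D where D: "\<And>x. (\<phi> has_vector_derivative D x) (at x)" "continuous_on UNIV D"
    using C1 unfolding C1_differentiable_on_def by auto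
  have D': "(\<phi> has_real_derivative D x) (at x)" for x
    using D(1)[of x] by (simp add: has_real_derivative_iff_has_vector_derivative)
  then have dD: "deriv \<phi> = D"
    by (intro ext DERIV_imp_deriv)
  have "bounded {x. \<phi> x \<noteq> 0}"
    using cpt compact_imp_bounded bounded_subset closure_subset by metis
  then obtain R where R: "\<And>x. \<phi> x \<noteq> 0 \<Longrightarrow> \<bar>x\<bar> \<le> R"
    unfolding bounded_iff by auto
  have z: "\<phi> x = 0" if "R < \<bar>x\<bar>" for x using R[of x] that by linarith
  have "D x = 0" if "R < \<bar>x\<bar>" for x
  proof -
    have "open {x::real. R < \<bar>x\<bar>}" by (intro open_Collect_less continuous_intros)
    then have "((\<lambda>_. 0) has_real_derivative D x) (at x)"
      using that z by (intro has_field_derivative_transform_within_open[OF D'[of x]]) auto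
    then show ?thesis using DERIV_unique DERIV_const by blast
  qed
  with that[of R] D' D(2) z le show thesis unfolding dD by blast
qed

text \<open>Integrating the derivative of a test function over a cell gives the difference of its
  values at the two grid points; summation by parts moves this difference onto
  \<open>U\<close>.\<close>

lemma BV_seminorm_step_le:
  assumes dx: "0 < dx" and T: "l1 (fdiff U) \<le> ennreal T" "0 \<le> T"
  shows "BV_seminorm (\<lambda>x. U \<lfloor>x / dx\<rfloor>) \<le> ereal T"
  unfolding BV_seminorm_def
proof (rule SUP_least)
  fix \<phi> assume "\<phi> \<in> BV_test_functions"
  then obtain R where \<phi>: "\<And>x. (\<phi> has_real_derivative deriv \<phi> x) (at x)" "continuous_on UNIV (deriv \<phi>)"
    "\<And>x. R < \<bar>x\<bar> \<Longrightarrow> \<phi> x = 0" "\<And>x. R < \<bar>x\<bar> \<Longrightarrow> deriv \<phi> x = 0" "\<And>x. \<bar>\<phi> x\<bar> \<le> 1"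
    by (rule BV_test_functionE) blast
  \<comment> \<open>\<open>N\<close> cells of width \<open>dx\<close> reach beyond the support
    radius \<open>R\<close>, so all sums become finite.\<close>
  obtain N where N: "R / dx < real N" using reals_Archimedean2 by blast
  have [measurable]: "deriv \<phi> \<in> borel_measurable borel"
    using \<phi>(2) by (rule borel_measurable_continuous_onI)
  define A where "A = {- int N..int N}"
  define p where "p i = \<phi> (of_int i * dx)" for i
  have far: "R < \<bar>of_int i * dx\<bar>" if "int N \<le> \<bar>i\<bar>" for i
  proof -
    have "real N \<le> \<bar>of_int i\<bar>" using that by linarith
    then have "real N * dx \<le> \<bar>of_int i\<bar> * dx" using dx by (intro mult_right_mono) auto
    moreover have "R < real N * dx" using N dx by (simp add: field_simps)
    ultimately have "R < \<bar>of_int i\<bar> * dx" by (rule less_le_trans[rotated])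
    then show ?thesis using dx by (simp add: abs_mult)
  qed
  have p0: "p i = 0" if "int N \<le> \<bar>i\<bar>" for i
    unfolding p_def using far[OF that] by (rule \<phi>(3))
  have p1: "\<bar>p i\<bar> \<le> 1" for i unfolding p_def by (rule \<phi>(5))
  \<comment> \<open>The fundamental theorem is applied on the closed cell; the half-open one, which
    matches the floor, differs by a null set.\<close>
  have cellint: "has_bochner_integral lborel
      (\<lambda>x. indicator {of_int i * dx..<of_int (i + 1) * dx} x * deriv \<phi> x) (p (i + 1) - p i)" for i
  proof -
    have le: "of_int i * dx \<le> of_int (i + 1) * dx" using dx by (intro mult_right_mono) auto
    have "has_bochner_integral lborel (\<lambda>x. deriv \<phi> x * indicator {of_int i * dx..of_int (i + 1) * dx} x) (p (i + 1) - p i)"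
      unfolding p_def using \<phi>(1,2) le
      by (intro has_bochner_integral_FTC_Icc_real) (auto simp: continuous_on_eq_continuous_at)
    moreover have "AE x in lborel. deriv \<phi> x * indicator {of_int i * dx..of_int (i + 1) * dx} x
        = indicator {of_int i * dx..<of_int (i + 1) * dx} x * deriv \<phi> x"
      using AE_lborel_singleton[of "of_int (i + 1) * dx"] by eventually_elim (auto simp: indicator_def)
    ultimately show ?thesis by (subst (asm) has_bochner_integral_cong_AE) auto
  qed
  have decomp: "U \<lfloor>x / dx\<rfloor> * deriv \<phi> x
      = (\<Sum>i\<in>A. U i * (indicator {of_int i * dx..<of_int (i + 1) * dx} x * deriv \<phi> x))" for x
  proof -
    have ind: "indicator {of_int i * dx..<of_int (i + 1) * dx} x = (if i = \<lfloor>x / dx\<rfloor> then 1 else 0 :: real)" for i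
      using floor_eq_iff_grid[OF dx, of x i] by (auto simp: indicator_def)
    have "(\<Sum>i\<in>A. U i * (indicator {of_int i * dx..<of_int (i + 1) * dx} x * deriv \<phi> x))
        = (\<Sum>i\<in>A. if i = \<lfloor>x / dx\<rfloor> then U i * deriv \<phi> x else 0)"
      unfolding ind by (intro sum.cong) auto
    also have "\<dots> = (if \<lfloor>x / dx\<rfloor> \<in> A then U \<lfloor>x / dx\<rfloor> * deriv \<phi> x else 0)"
      by (simp add: A_def)
    also have "\<dots> = U \<lfloor>x / dx\<rfloor> * deriv \<phi> x"
    proof (cases "\<lfloor>x / dx\<rfloor> \<in> A")
      case False
      then have "x / dx < - real N \<or> real N + 1 \<le> x / dx"
        by (auto simp: A_def not_le floor_less_iff less_floor_iff)
      then have "real N \<le> \<bar>x / dx\<bar>" by linarith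
      then have "real N * dx \<le> \<bar>x\<bar>" using dx by (simp add: abs_divide pos_le_divide_eq)
      moreover have "R < real N * dx" using N dx by (simp add: field_simps)
      ultimately have "deriv \<phi> x = 0" by (intro \<phi>(4)) linarith
      then show ?thesis by simp
    qed simp
    finally show ?thesis by simp
  qed
  have "(LINT x|lebesgue. U \<lfloor>x / dx\<rfloor> * deriv \<phi> x) = (LINT x|lborel. U \<lfloor>x / dx\<rfloor> * deriv \<phi> x)"
    by (rule integral_completion) measurable
  also have "\<dots> = (\<Sum>i\<in>A. U i * (p (i + 1) - p i))"
    unfolding decomp
    by (intro has_bochner_integral_integral_eq has_bochner_integral_sum has_bochner_integral_mult_right cellint)
  \<comment> \<open>Summation by parts: \<open>U i * (p (i + 1) - p i)\<close> is the increment of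
    \<open>U i * p i\<close> minus \<open>fdiff U i * p (i + 1)\<close>.\<close>
  also have "\<dots> = (\<Sum>i\<in>A. U (i + 1) * p (i + 1)) - (\<Sum>i\<in>A. U i * p i) - (\<Sum>i\<in>A. fdiff U i * p (i + 1))"
    by (simp add: fdiff_def algebra_simps sum.distrib sum_subtractf)
  also have "(\<Sum>i\<in>A. U (i + 1) * p (i + 1)) = (\<Sum>i\<in>A. U i * p i)"
  proof -
    \<comment> \<open>The shifted range loses \<open>- int N\<close> and gains
      \<open>int N + 1\<close>; \<open>p\<close> vanishes at both.\<close>
    have "(\<Sum>i\<in>A. U (i + 1) * p (i + 1)) = (\<Sum>i\<in>{- int N + 1..int N + 1}. U i * p i)"
      unfolding A_def by (rule sum.reindex_bij_witness[of _ "\<lambda>i. i - 1" "\<lambda>i. i + 1"]) auto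
    also have "\<dots> = (\<Sum>i\<in>{- int N..int N + 1}. U i * p i)"
      by (rule sum.mono_neutral_left) (auto intro!: p0)
    also have "\<dots> = (\<Sum>i\<in>A. U i * p i)"
      unfolding A_def by (rule sum.mono_neutral_right) (auto intro!: p0)
    finally show ?thesis .
  qed
  also have "(\<Sum>i\<in>A. U i * p i) - (\<Sum>i\<in>A. U i * p i) - (\<Sum>i\<in>A. fdiff U i * p (i + 1))
      \<le> (\<Sum>i\<in>A. \<bar>fdiff U i\<bar>)"
  proof -
    have "- (fdiff U i * p (i + 1)) \<le> \<bar>fdiff U i\<bar>" for i
      using mult_left_mono[OF p1[of "i + 1"], of "\<bar>fdiff U i\<bar>"]
        abs_ge_minus_self[of "fdiff U i * p (i + 1)"] by (simp add: abs_mult)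
    then show ?thesis by (simp add: sum_negf[symmetric] sum_mono)
  qed
  also have "(\<Sum>i\<in>A. \<bar>fdiff U i\<bar>) \<le> T"
  proof -
    have "ennreal (\<Sum>i\<in>A. \<bar>fdiff U i\<bar>) \<le> ennreal T"
      using sum_le_l1[of A "fdiff U"] T(1) unfolding A_def by (meson finite_atLeastAtMost_int order_trans)
    then show ?thesis using T(2) by simp
  qed
  finally show "ereal (LINT x|lebesgue. U \<lfloor>x / dx\<rfloor> * deriv \<phi> x) \<le> ereal T" by simp
qed


section \<open>Total variation of the cell averages\<close>

lemma sum_hat_le:
  assumes "0 < dx" "finite A"
  shows "(\<Sum>k\<in>A. hat dx k z) \<le> dx"
proof -
  have "ennreal (\<Sum>k\<in>A. \<bar>hat dx k z\<bar>) \<le> l1 (\<lambda>k. hat dx k z)"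
    using assms(2) by (rule sum_le_l1)
  also have "\<dots> = ennreal dx"
    unfolding l1_def using nn_integral_hat[OF assms(1), of z] by simp
  finally show ?thesis using assms(1) by (simp add: ennreal_le_iff)
qed

text \<open>The hat has slope 1 on the cell left of its peak and -1 on the cell right of it. The
  symmetric quotient equals the slope as soon as \<open>h n\<close> is below the distance
  \<open>e\<close> from \<open>x\<close> to the ends of its cell.\<close>

lemma hat_difference_quotient_tendsto:
  assumes dx: "0 < dx" and x: "x \<in> cell dx m" and h: "h \<longlonglongrightarrow> 0" "\<And>n. 0 < h n"
  shows "(\<lambda>n. (hat dx i (x + h n) - hat dx i (x - h n)) / (2 * h n))
    \<longlonglongrightarrow> indicator (cell dx (i - 1)) x - indicator (cell dx i) x"
proof (rule tendsto_eventually)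
  define e where "e = min (x - of_int m * dx) ((of_int m + 1) * dx - x)"
  have "0 < e" using x by (auto simp: e_def cell_def algebra_simps)
  then have "eventually (\<lambda>n. h n < e) sequentially"
    using h(1) by (auto dest: order_tendstoD)
  then show "eventually (\<lambda>n. (hat dx i (x + h n) - hat dx i (x - h n)) / (2 * h n)
      = indicator (cell dx (i - 1)) x - indicator (cell dx i) x) sequentially"
  proof eventually_elim
    case (elim n)
    have b: "of_int m * dx \<le> x - h n" "x + h n < (of_int m + 1) * dx"
      using elim unfolding e_def by auto
    have 1: "hat dx i (x + h n) = (if i = m then (of_int m + 1) * dx - (x + h n)
        else if i = m + 1 then x + h n - of_int m * dx else 0)"
      using b h(2)[of n] by (intro hat_on_cells dx) auto
    have 2: "hat dx i (x - h n) = (if i = m then (of_int m + 1) * dx - (x - h n)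
        else if i = m + 1 then x - h n - of_int m * dx else 0)"
      using b h(2)[of n] by (intro hat_on_cells dx) auto
    have 3: "x \<in> cell dx k \<longleftrightarrow> k = m" for k
      using cell_imp_floor_eq[OF dx x] cell_imp_floor_eq[OF dx, of x k] x by auto
    show ?case
      unfolding 1 2 using h(2)[of n] by (auto simp: indicator_def 3 field_simps)
  qed
qed

lemma AE_in_cell:
  assumes "0 < dx"
  shows "AE x in lebesgue. x \<in> cell dx \<lfloor>x / dx\<rfloor>"
proof -
  have "AE x in lborel. \<forall>i::int. x \<noteq> of_int i * dx"
    by (subst AE_all_countable) (auto intro: AE_lborel_singleton)
  then have "AE x in lborel. x \<in> cell dx \<lfloor>x / dx\<rfloor>"
  proof eventually_elim
    case (elim x)
    then have "of_int \<lfloor>x / dx\<rfloor> * dx < x"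
      using cell_index(1)[OF assms, of x] elim[rule_format, of "\<lfloor>x / dx\<rfloor>"] by linarith
    then show ?case
      using cell_index(2)[OF assms, of x] by (simp add: cell_def)
  qed
  then show ?thesis by (rule AE_completion)
qed

text \<open>Dominated convergence with majorant \<open>\<bar>u\<bar>\<close>, the quotients being
  bounded by 1 since hats are 1-Lipschitz. Testing \<open>u\<close> with the slope of a hat yields
  the jump between adjacent cell averages.\<close>

lemma hat_difference_quotient_integral_tendsto:
  assumes dx: "0 < dx" and u: "integrable lebesgue u" and h: "h \<longlonglongrightarrow> 0" "\<And>n. 0 < h n"
  shows "integrable lebesgue (\<lambda>x. u x * ((hat dx i (x + h n) - hat dx i (x - h n)) / (2 * h n)))"
    and "(\<lambda>n. LINT x|lebesgue. u x * ((hat dx i (x + h n) - hat dx i (x - h n)) / (2 * h n)))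
      \<longlonglongrightarrow> dx * (cell_average dx u (i - 1) - cell_average dx u i)"
proof -
  let ?s = "\<lambda>n x. u x * ((hat dx i (x + h n) - hat dx i (x - h n)) / (2 * h n))"
  let ?f = "\<lambda>x. u x * (indicator (cell dx (i - 1)) x - indicator (cell dx i) x)"
  have [measurable]: "u \<in> borel_measurable lebesgue" using u by simp
  have q_meas: "(\<lambda>x. (hat dx i (x + h n) - hat dx i (x - h n)) / (2 * h n)) \<in> borel_measurable lebesgue" for n
    by (rule measurable_completion) measurable
  have f: "?f = (\<lambda>x. indicator (cell dx (i - 1)) x * u x - indicator (cell dx i) x * u x)"
    by (auto simp: algebra_simps)
  have lim: "AE x in lebesgue. (\<lambda>n. ?s n x) \<longlonglongrightarrow> ?f x"
    using AE_in_cell[OF dx] by eventually_elim (intro tendsto_mult_left hat_difference_quotient_tendsto[OF dx _ h])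
  have bound: "norm (?s n x) \<le> \<bar>u x\<bar>" for n x
  proof -
    have "\<bar>(hat dx i (x + h n) - hat dx i (x - h n)) / (2 * h n)\<bar> \<le> 1"
      using hat_lipschitz[of dx i "x + h n" "x - h n"] h(2)[of n] by (simp add: abs_divide)
    then have "\<bar>u x\<bar> * \<bar>(hat dx i (x + h n) - hat dx i (x - h n)) / (2 * h n)\<bar> \<le> \<bar>u x\<bar> * 1"
      by (intro mult_left_mono) auto
    then show ?thesis by (simp only: abs_mult real_norm_def mult_1_right)
  qed
  have s_meas: "?s n \<in> borel_measurable lebesgue" for n
    using q_meas by (intro borel_measurable_times) auto
  have f_meas: "?f \<in> borel_measurable lebesgue"
    unfolding f using integrable_on_cell[OF u] by (intro borel_measurable_diff) auto
  have w: "integrable lebesgue (\<lambda>x. \<bar>u x\<bar>)" using u by simp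
  show "integrable lebesgue (?s n)"
    by (rule Bochner_Integration.integrable_bound[OF u s_meas]) (use bound in auto)
  have "(\<lambda>n. LINT x|lebesgue. ?s n x) \<longlonglongrightarrow> (LINT x|lebesgue. ?f x)"
    by (rule integral_dominated_convergence[OF f_meas s_meas w lim]) (use bound in auto)
  also have "(LINT x|lebesgue. ?f x) = dx * (cell_average dx u (i - 1) - cell_average dx u i)"
    unfolding f using integrable_on_cell[OF u] dx
    by (simp add: cell_average_def set_lebesgue_integral_def right_diff_distrib)
  finally show "(\<lambda>n. LINT x|lebesgue. ?s n x) \<longlonglongrightarrow> dx * (cell_average dx u (i - 1) - cell_average dx u i)" .
qed

text \<open>The Steklov average over an interval of length \<open>2 h\<close> turns a continuous function into a
  continuously differentiable one.\<close>

lemma steklov_average_test_function: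
  fixes \<psi> :: "real \<Rightarrow> real"
  assumes cont: "continuous_on UNIV \<psi>" and le: "\<And>x. \<bar>\<psi> x\<bar> \<le> 1"
    and supp: "\<And>x. R < \<bar>x\<bar> \<Longrightarrow> \<psi> x = 0" and h: "0 < h"
  obtains \<phi> where "\<phi> \<in> BV_test_functions" "deriv \<phi> = (\<lambda>x. (\<psi> (x + h) - \<psi> (x - h)) / (2 * h))"
proof -
  have "\<exists>P. \<forall>x::real. - \<infinity> < ereal x \<longrightarrow> ereal x < \<infinity> \<longrightarrow> (P has_vector_derivative \<psi> x) (at x)"
    using cont by (intro einterval_antiderivative) (auto simp: continuous_on_eq_continuous_at)
  then obtain P where P: "\<And>x. (P has_real_derivative \<psi> x) (at x)"
    by (auto simp: has_real_derivative_iff_has_vector_derivative)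
  define \<phi> where "\<phi> x = (P (x + h) - P (x - h)) / (2 * h)" for x
  have d: "(\<phi> has_real_derivative (\<psi> (x + h) - \<psi> (x - h)) / (2 * h)) (at x)" for x
    unfolding \<phi>_def using h
    by (auto intro!: derivative_eq_intros DERIV_chain2[OF P] simp: field_simps)
  \<comment> \<open>By the mean value theorem the average is a value of \<open>\<psi>\<close>
    nearby; this gives both the bound by 1 and the compact support.\<close>
  have mean: "\<exists>y. x - h < y \<and> y < x + h \<and> \<phi> x = \<psi> y" for x
  proof -
    have "\<exists>z>x - h. z < x + h \<and> P (x + h) - P (x - h) = (x + h - (x - h)) * \<psi> z"
      using h by (intro MVT2 P) auto
    then show ?thesis using h by (auto simp: \<phi>_def)
  qed
  have "\<phi> C1_differentiable_on UNIV"
    unfolding C1_differentiable_on_def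
  proof (intro exI conjI ballI)
    show "(\<phi> has_vector_derivative (\<psi> (x + h) - \<psi> (x - h)) / (2 * h)) (at x)" for x
      using d[of x] by (simp add: has_real_derivative_iff_has_vector_derivative)
    show "continuous_on UNIV (\<lambda>x. (\<psi> (x + h) - \<psi> (x - h)) / (2 * h))"
      using h by (intro continuous_intros continuous_on_compose2[OF cont]) auto
  qed
  moreover have "compact (closure {x. \<phi> x \<noteq> 0})"
  proof -
    have "\<bar>x\<bar> \<le> R + h" if nz: "\<phi> x \<noteq> 0" for x
    proof -
      obtain y where "x - h < y" "y < x + h" "\<psi> y \<noteq> 0" using mean[of x] nz by metis
      moreover have "\<bar>y\<bar> \<le> R" using supp[of y] \<open>\<psi> y \<noteq> 0\<close> by linarith
      ultimately show ?thesis by linarith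
    qed
    then have "bounded {x. \<phi> x \<noteq> 0}"
      unfolding bounded_iff by (intro exI[of _ "R + h"]) auto
    then show ?thesis by simp
  qed
  moreover have "\<bar>\<phi> x\<bar> \<le> 1" for x
    using mean[of x] le by auto
  ultimately have "\<phi> \<in> BV_test_functions" by (simp add: BV_test_functions_def)
  moreover have "deriv \<phi> = (\<lambda>x. (\<psi> (x + h) - \<psi> (x - h)) / (2 * h))"
    using d by (intro ext DERIV_imp_deriv)
  ultimately show thesis by (rule that)
qed

text \<open>Duality: the signs of finitely many jumps are the nodal values of a piecewise linear
  \<open>\<psi>\<close>, bounded by 1 through the partition of unity. As \<open>\<psi>\<close> need
  not be continuously differentiable, its Steklov averages are the test functions, and their width
  tends to 0.\<close>

lemma l1_fdiff_cell_average_le: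
  assumes dx: "0 < dx" and u: "integrable lebesgue u" and T: "BV_seminorm u \<le> ereal T"
  shows "l1 (fdiff (cell_average dx u)) \<le> ennreal T"
proof -
  let ?U = "cell_average dx u"
  \<comment> \<open>The backward difference attaches each jump to the grid point at the peak of the
    hat with the same index.\<close>
  define D where "D i = ?U i - ?U (i - 1)" for i
  have "l1 D \<le> ennreal T"
  proof (rule l1_le_if_finite_sums_le)
    fix A :: "int set" assume A: "finite A"
    define h where "h n = 1 / real (Suc n)" for n
    have h: "h \<longlonglongrightarrow> 0" "\<And>n. 0 < h n"
      unfolding h_def using LIMSEQ_inverse_real_of_nat by (auto simp: inverse_eq_divide)
    \<comment> \<open>The minus sign compensates that the limit of the tested hats is
      \<open>U (i - 1) - U i\<close>.\<close>
    define s where "s i = - sgn (D i)" for i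
    have s1: "\<bar>s i\<bar> \<le> 1" for i by (simp add: s_def sgn_if)
    define \<psi> where "\<psi> x = (\<Sum>i\<in>A. s i / dx * hat dx i x)" for x
    have cont: "continuous_on UNIV \<psi>"
      unfolding \<psi>_def by (intro continuous_intros continuous_on_hat)
    have le: "\<bar>\<psi> x\<bar> \<le> 1" for x
    proof -
      have "\<bar>\<psi> x\<bar> \<le> (\<Sum>i\<in>A. \<bar>s i / dx * hat dx i x\<bar>)"
        unfolding \<psi>_def by (rule sum_abs)
      also have "\<dots> \<le> (\<Sum>i\<in>A. 1 / dx * hat dx i x)"
      proof (rule sum_mono)
        fix i
        have "\<bar>s i\<bar> * (hat dx i x / dx) \<le> 1 * (hat dx i x / dx)"
          using dx by (intro mult_right_mono s1) auto
        then show "\<bar>s i / dx * hat dx i x\<bar> \<le> 1 / dx * hat dx i x"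
          using dx by (simp add: abs_mult)
      qed
      also have "\<dots> = (\<Sum>i\<in>A. hat dx i x) / dx"
        by (simp add: sum_divide_distrib)
      also have "\<dots> \<le> 1"
        using sum_hat_le[OF dx A, of x] dx by (simp add: divide_le_eq)
      finally show ?thesis .
    qed
    \<comment> \<open>The hat with index \<open>i\<close> vanishes beyond
      \<open>(\<bar>i\<bar> + 1) * dx\<close>.\<close>
    obtain R where R: "\<And>i. i \<in> A \<Longrightarrow> (\<bar>of_int i\<bar> + 1) * dx \<le> R"
      using bdd_above_finite[OF finite_imageI[OF A, of "\<lambda>i. (\<bar>of_int i\<bar> + 1) * dx"]]
      unfolding bdd_above_def by auto
    have supp: "\<psi> x = 0" if "R < \<bar>x\<bar>" for x
      unfolding \<psi>_def
    proof (rule sum.neutral, rule ballI)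
      fix i assume "i \<in> A"
      then have "(\<bar>of_int i\<bar> + 1) * dx < \<bar>x\<bar>" using R that by fastforce
      moreover have "\<bar>of_int i * dx\<bar> = \<bar>of_int i\<bar> * dx" using dx by (simp add: abs_mult)
      ultimately have "dx \<le> \<bar>x - of_int i * dx\<bar>" by (simp add: algebra_simps)
      then show "s i / dx * hat dx i x = 0" by (simp add: hat_def)
    qed
    let ?q = "\<lambda>i n x. (hat dx i (x + h n) - hat dx i (x - h n)) / (2 * h n)"
    note q = hat_difference_quotient_integral_tendsto[OF dx u h]
    have "(\<Sum>i\<in>A. s i / dx * (LINT x|lebesgue. u x * ?q i n x)) \<le> T" for n
    proof -
      obtain \<phi> where \<phi>: "\<phi> \<in> BV_test_functions" "deriv \<phi> = (\<lambda>x. (\<psi> (x + h n) - \<psi> (x - h n)) / (2 * h n))"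
        by (rule steklov_average_test_function[OF cont le supp h(2)])
      have "u x * deriv \<phi> x = (\<Sum>i\<in>A. s i / dx * (u x * ?q i n x))" for x
        unfolding \<phi>(2) \<psi>_def
        by (simp add: sum_subtractf[symmetric] sum_divide_distrib sum_distrib_left algebra_simps diff_divide_distrib)
      then have "(LINT x|lebesgue. u x * deriv \<phi> x) = (LINT x|lebesgue. (\<Sum>i\<in>A. s i / dx * (u x * ?q i n x)))"
        by (simp only:)
      also have "\<dots> = (\<Sum>i\<in>A. (LINT x|lebesgue. s i / dx * (u x * ?q i n x)))"
        by (intro Bochner_Integration.integral_sum integrable_mult_right q(1))
      also have "\<dots> = (\<Sum>i\<in>A. s i / dx * (LINT x|lebesgue. u x * ?q i n x))"
        by (simp only: integral_mult_right_zero)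
      finally have "(LINT x|lebesgue. u x * deriv \<phi> x) = (\<Sum>i\<in>A. s i / dx * (LINT x|lebesgue. u x * ?q i n x))" .
      moreover have "ereal (LINT x|lebesgue. u x * deriv \<phi> x) \<le> BV_seminorm u"
        unfolding BV_seminorm_def using \<phi>(1) by (rule SUP_upper)
      ultimately show ?thesis using T by (metis ereal_less_eq(3) order_trans)
    qed
    moreover have "(\<lambda>n. \<Sum>i\<in>A. s i / dx * (LINT x|lebesgue. u x * ?q i n x))
        \<longlonglongrightarrow> (\<Sum>i\<in>A. s i / dx * (dx * (?U (i - 1) - ?U i)))"
      by (intro tendsto_sum tendsto_mult_left q(2))
    ultimately have "(\<Sum>i\<in>A. s i / dx * (dx * (?U (i - 1) - ?U i))) \<le> T"
      by (intro LIMSEQ_le_const2) auto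
    also have "(\<Sum>i\<in>A. s i / dx * (dx * (?U (i - 1) - ?U i))) = (\<Sum>i\<in>A. \<bar>D i\<bar>)"
      using dx by (intro sum.cong) (auto simp: s_def D_def sgn_if)
    finally show "(\<Sum>i\<in>A. \<bar>D i\<bar>) \<le> T" .
  qed
  moreover have "l1 (fdiff ?U) = l1 D"
    using l1_shift[of D 1] by (simp add: D_def fdiff_def[abs_def])
  ultimately show ?thesis by simp
qed


section \<open>The two methods as monotone schemes\<close>

lemma discrete_frac_lap_eq:
  assumes lam: "0 < lam" "lam < 1" and dx: "0 < dx"
  shows "discrete_frac_lap lam dx U i = 1 / dx * (\<Sum>\<^sub>\<infinity>k. jump_weight lam dx k * U (i + k))"
proof -
  have "bij_betw (\<lambda>k. i + k) UNIV (UNIV :: int set)"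
    by (rule bij_betwI[where g = "\<lambda>j. j - i"]) auto
  from infsum_reindex_bij_betw[OF this, of "\<lambda>j. jump_weight lam dx (j - i) * U j"]
  show ?thesis
    unfolding discrete_frac_lap_def G_weight_eq[OF assms] by simp
qed

locale discretization =
  fixes lam F1 F2 dx dt :: real and f u0 :: "real \<Rightarrow> real" and F :: "real \<Rightarrow> real \<Rightarrow> real"
    and U :: "nat \<Rightarrow> int \<Rightarrow> real"
  assumes lam: "0 < lam" "lam < 1"
    and flux: "numerical_flux f F" "flux_lipschitz_constants F F1 F2"
    and u0: "integrable lebesgue u0" "BV_seminorm u0 < \<infinity>"
    and dx: "0 < dx" and dt: "0 < dt"
    and generated: "generated_with_CFL lam F F1 F2 u0 dx dt U"
begin

sublocale monotone_scheme "jump_weight lam dx" "d_const lam * dx powr (1 - lam)" F F1 F2 "dt / dx"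
proof (intro monotone_scheme.intro jump_weights_jump_weight lam dx)
  show "monotone_flux F F1 F2"
    using flux unfolding numerical_flux_def flux_lipschitz_constants_def by unfold_locales auto
  show "monotone_scheme_axioms (dt / dx)"
    using dx dt by unfold_locales auto
qed

lemma start: "U 0 = cell_average dx u0"
  using generated
  by (auto simp: generated_with_CFL_def implicit_explicit_method_def explicit_method_def)

lemma steps: "scheme_step (U n) (U (Suc n))"
proof -
  have flux_eq: "V i - dt * flux_difference F dx V i = flux_step (dt / dx) V i" for V i
    by (simp add: flux_difference_def flux_step_def)
  have jump_eq: "dt * discrete_frac_lap lam dx V i = dt / dx * jump_op V i" for V i
    by (simp add: discrete_frac_lap_eq[OF lam dx] jump_op_def)
  \<comment> \<open>With this identity \<open>r * W\<close> becomes the second term of the explicit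
    CFL condition.\<close>
  have W: "dt / dx * (d_const lam * dx powr (1 - lam)) = d_const lam * (dt / dx powr lam)"
    using dx by (simp add: powr_diff)
  show ?thesis
    using generated unfolding generated_with_CFL_def
  proof (elim disjE conjE)
    assume "explicit_method lam F u0 dx dt U" "explicit_CFL lam F1 F2 dx dt"
    then show ?thesis
      unfolding explicit_method_def explicit_CFL_def scheme_step_def W flux_eq jump_eq by blast
  next
    assume "implicit_explicit_method lam F u0 dx dt U" "implicit_explicit_CFL F1 F2 dx dt"
    then show ?thesis
      unfolding implicit_explicit_method_def implicit_explicit_CFL_def scheme_step_def flux_eq jump_eq
        in_linf_l1_def l1_finite_iff_abs_summable by blast
  qed
qed

lemma L1_u0_finite: "L1_norm u0 < \<infinity>"
  using u0(1) unfolding L1_norm_def integrable_iff_bounded by simp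

lemma start_finite: "l1 (U 0) < \<infinity>"
proof -
  have "ennreal dx * l1 (U 0) < \<infinity>"
    unfolding start using l1_cell_average_le[OF dx u0(1)] L1_u0_finite by (rule le_less_trans)
  then show ?thesis
    using dx by (auto simp: ennreal_mult_less_top)
qed

lemma l1_le_L1_norm: "ennreal dx * l1 (U n) \<le> L1_norm u0"
proof -
  have "ennreal dx * l1 (U n) \<le> ennreal dx * l1 (U 0)"
    by (intro mult_left_mono scheme_l1[OF steps start_finite]) simp
  also have "\<dots> \<le> L1_norm u0"
    unfolding start by (rule l1_cell_average_le[OF dx u0(1)])
  finally show ?thesis .
qed

lemma BV_u0:
  obtains T where "0 \<le> T" "BV_seminorm u0 = ereal T"
proof -
  \<comment> \<open>The zero test function excludes the value minus infinity of the
    supremum.\<close>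
  have "(\<lambda>_. 0) \<in> BV_test_functions"
    by (simp add: BV_test_functions_def)
  then have "ereal (LINT x|lebesgue. u0 x * deriv (\<lambda>_. 0) x) \<le> BV_seminorm u0"
    unfolding BV_seminorm_def by (rule SUP_upper)
  then have "0 \<le> BV_seminorm u0" by (simp add: zero_ereal_def)
  with u0(2) that show thesis by (cases "BV_seminorm u0") auto
qed

lemma fdiff_le:
  assumes "BV_seminorm u0 = ereal T"
  shows "l1 (fdiff (U n)) \<le> ennreal T"
  using scheme_fdiff[OF steps start_finite] l1_fdiff_cell_average_le[OF dx u0(1)] assms
  unfolding start by (metis order_refl order_trans)

section \<open>Stability in the sup norm, in L1 and in total variation\<close>

lemma Linf_stable: "Linf_norm (\<lambda>x. interpolation dx dt U x t) \<le> Linf_norm u0"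
proof (cases "Linf_norm u0 = \<infinity>")
  case False
  define M where "M = enn2real (Linf_norm u0)"
  have "Linf_norm u0 < top" by (metis False top.not_eq_extremum infinity_ennreal_def)
  then have M: "Linf_norm u0 = ennreal M" by (simp add: M_def)
  have "AE x in lebesgue. ennreal \<bar>u0 x\<bar> \<le> Linf_norm u0"
    unfolding Linf_norm_def by (rule esssup_AE)
  then have "AE x in lebesgue. \<bar>u0 x\<bar> \<le> M"
    unfolding M by eventually_elim (simp add: M_def)
  then have "\<bar>U 0 i\<bar> \<le> M" for i
    unfolding start by (rule cell_average_le[OF dx u0(1)])
  then have "\<bar>U n i\<bar> \<le> M" for n i
    by (rule scheme_maximum[OF steps start_finite])
  then show ?thesis
    unfolding M interpolation_def by (rule Linf_norm_step_le)
qed simp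

lemma L1_stable: "L1_norm (\<lambda>x. interpolation dx dt U x t) \<le> L1_norm u0"
  unfolding interpolation_def L1_norm_step[OF dx] by (rule l1_le_L1_norm)

lemma BV_stable: "BV_seminorm (\<lambda>x. interpolation dx dt U x t) \<le> BV_seminorm u0"
proof -
  obtain T where T: "0 \<le> T" "BV_seminorm u0 = ereal T" by (rule BV_u0)
  show ?thesis
    unfolding interpolation_def T(2) by (rule BV_seminorm_step_le[OF dx fdiff_le[OF T(2)] T(1)])
qed

section \<open>Continuity in time\<close>

lemma l1_jump_op_bound:
  assumes "BV_seminorm u0 = ereal T"
  shows "l1 (jump_op (U n)) \<le> ennreal (d_const lam) * (ennreal T + 2 * L1_norm u0)"
proof -
  obtain M where M: "\<And>i. \<bar>U n i\<bar> \<le> M"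
    using l1_finite_imp_bounded[OF scheme_l1_finite[OF steps start_finite]] by blast
  have "l1 (\<lambda>i. U n (i + k) - U n i) \<le> 2 * l1 (U n)" for k
    using l1_triangle_diff[of "\<lambda>i. U n (i + k)" "U n"] by (simp add: l1_shift mult_2)
  then have "l1 (jump_op (U n)) \<le> ennreal (d_const lam) * (l1 (fdiff (U n)) + ennreal dx * (2 * l1 (U n)))"
    by (intro order_trans[OF l1_jump_op_le[OF M]] jump_weight_moment lam dx l1_shift_difference)
  \<comment> \<open>The factor \<open>dx\<close> from the long jumps joins \<open>l1 (U n)\<close>
    to form an L1 norm on the line, so the bound is free of grid parameters.\<close>
  also have "\<dots> = ennreal (d_const lam) * (l1 (fdiff (U n)) + 2 * (ennreal dx * l1 (U n)))"
    by (simp add: mult_ac)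
  also have "\<dots> \<le> ennreal (d_const lam) * (ennreal T + 2 * L1_norm u0)"
    by (intro mult_left_mono add_mono fdiff_le assms l1_le_L1_norm) auto
  finally show ?thesis .
qed

text \<open>Either CFL condition bounds a time step by a multiple of the cell width; this absorbs
  the rounding of times into the \<open>dx\<close> term.\<close>

lemma dt_le: "dt \<le> dx / (F1 + F2)"
proof -
  have "0 \<le> d_const lam * (dt / dx powr lam)"
    using d_const_nonneg[OF lam] dt by simp
  then have "(F1 + F2) * (dt / dx) \<le> 1"
    using generated unfolding generated_with_CFL_def implicit_explicit_CFL_def explicit_CFL_def
    by linarith
  then show ?thesis
    using dx F1_pos F2_pos by (simp add: field_simps)
qed

text \<open>Bounds the L1 change per unit of time. It involves only \<open>lam\<close>,
  \<open>F1\<close>, \<open>F2\<close> and \<open>u0\<close>, so outside the locale it is one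
  constant for all grids.\<close>

definition time_speed :: real where
  "time_speed = (F1 + F2) * real_of_ereal (BV_seminorm u0)
     + d_const lam * (real_of_ereal (BV_seminorm u0) + 2 * enn2real (L1_norm u0))"

lemma time_speed_nonneg: "0 \<le> time_speed"
proof -
  obtain T where "0 \<le> T" "BV_seminorm u0 = ereal T" by (rule BV_u0)
  then show ?thesis
    unfolding time_speed_def using F1_pos F2_pos d_const_nonneg[OF lam] by simp
qed

lemma grid_time_continuity:
  assumes "m \<le> n"
  shows "ennreal dx * l1 (\<lambda>i. U n i - U m i) \<le> ennreal (real (n - m) * dt * time_speed)"
proof -
  obtain T where T: "0 \<le> T" "BV_seminorm u0 = ereal T" by (rule BV_u0)
  let ?K = "ennreal (d_const lam) * (ennreal T + 2 * L1_norm u0)"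
  have L: "L1_norm u0 = ennreal (enn2real (L1_norm u0))" using L1_u0_finite by simp
  have K: "?K = ennreal (d_const lam * (T + 2 * enn2real (L1_norm u0)))"
    using T(1) d_const_nonneg[OF lam]
    by (subst L) (simp add: ennreal_mult ennreal_plus)
  have "l1 (\<lambda>i. U n i - U m i)
      \<le> of_nat (n - m) * (ennreal (dt / dx) * (ennreal (F1 + F2) * l1 (fdiff (U 0)) + ?K))"
    using assms by (intro scheme_time_continuity[OF steps start_finite] l1_jump_op_bound T)
  also have "\<dots> \<le> of_nat (n - m) * (ennreal (dt / dx) * (ennreal (F1 + F2) * ennreal T + ?K))"
    by (intro mult_left_mono add_mono fdiff_le T) auto
  also have "\<dots> = ennreal (real (n - m) * (dt / dx * time_speed))"
    unfolding K time_speed_def T(2) using T(1) F1_pos F2_pos dx dt d_const_nonneg[OF lam]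
    by (simp add: ennreal_of_nat_eq_real_of_nat flip: ennreal_mult ennreal_plus)
  finally have "ennreal dx * l1 (\<lambda>i. U n i - U m i) \<le> ennreal dx * ennreal (real (n - m) * (dt / dx * time_speed))"
    by (intro mult_left_mono) auto
  also have "\<dots> = ennreal (real (n - m) * dt * time_speed)"
    using dx dt time_speed_nonneg by (simp flip: ennreal_mult)
  finally show ?thesis .
qed

lemma time_continuity_ordered:
  assumes "0 \<le> s" "s \<le> t"
  shows "L1_norm (\<lambda>x. interpolation dx dt U x t - interpolation dx dt U x s)
    \<le> ennreal ((1 + 1 / (F1 + F2)) * time_speed * (\<bar>s - t\<bar> + dx))"
proof -
  define m where "m = nat \<lfloor>s / dt\<rfloor>"
  define n where "n = nat \<lfloor>t / dt\<rfloor>"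
  have st: "s / dt \<le> t / dt" using assms dt by (intro divide_right_mono) auto
  then have mn: "m \<le> n" unfolding m_def n_def by (intro nat_mono floor_mono)
  have "0 \<le> s / dt" using assms dt by simp
  then have "s / dt < real m + 1" "real n \<le> t / dt"
    unfolding m_def n_def using st by linarith+
  \<comment> \<open>Rounding both times down to the time grid costs at most one extra step.\<close>
  then have "real n - real m \<le> (t - s) / dt + 1" by (simp add: diff_divide_distrib)
  then have "real (n - m) * dt \<le> (t - s) + dt"
    using mn dt by (simp add: of_nat_diff field_simps)
  also have "\<dots> \<le> \<bar>s - t\<bar> + dx / (F1 + F2)" using dt_le assms by simp
  \<comment> \<open>The product contains both wanted terms; the remaining two are
    nonnegative.\<close>
  also have "\<dots> \<le> (1 + 1 / (F1 + F2)) * (\<bar>s - t\<bar> + dx)"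
  proof -
    have "0 \<le> dx + \<bar>s - t\<bar> / (F1 + F2)" using dx F1_pos F2_pos by simp
    then show ?thesis by (simp add: distrib_left distrib_right)
  qed
  finally have "real (n - m) * dt * time_speed \<le> (1 + 1 / (F1 + F2)) * (\<bar>s - t\<bar> + dx) * time_speed"
    using time_speed_nonneg by (rule mult_right_mono)
  then have le: "ennreal (real (n - m) * dt * time_speed) \<le> ennreal ((1 + 1 / (F1 + F2)) * time_speed * (\<bar>s - t\<bar> + dx))"
    by (intro ennreal_leI) (simp add: mult_ac)
  have L1: "L1_norm (\<lambda>x. interpolation dx dt U x t - interpolation dx dt U x s)
      = ennreal dx * l1 (\<lambda>i. U n i - U m i)"
    unfolding interpolation_def m_def n_def
    using L1_norm_step[OF dx, of "\<lambda>i. U (nat \<lfloor>t / dt\<rfloor>) i - U (nat \<lfloor>s / dt\<rfloor>) i"] .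
  show ?thesis
    unfolding L1 by (rule order_trans[OF grid_time_continuity[OF mn] le])
qed

lemma time_continuity:
  assumes "0 \<le> s" "0 \<le> t"
  shows "L1_norm (\<lambda>x. interpolation dx dt U x s - interpolation dx dt U x t)
    \<le> ennreal ((1 + 1 / (F1 + F2)) * time_speed * (\<bar>s - t\<bar> + dx))"
proof (cases "s \<le> t")
  case True
  then show ?thesis
    using time_continuity_ordered[OF assms(1) True] by (simp add: L1_norm_def abs_minus_commute)
next
  case False
  then show ?thesis
    using time_continuity_ordered[of t s] assms(2) by (simp add: abs_minus_commute)
qed

end

theorem theorem4p2:
  fixes lam F1 F2 :: real
    and f u0 :: "real \<Rightarrow> real"
    and F :: "real \<Rightarrow> real \<Rightarrow> real"
  assumes "0 < lam" and "lam < 1"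
    and "\<exists>L. L-lipschitz_on UNIV f"
    and "numerical_flux f F"
    and "flux_lipschitz_constants F F1 F2"
    and "integrable lebesgue u0" and "BV_seminorm u0 < \<infinity>"
  shows "(\<forall>dx dt U. 0 < dx \<longrightarrow> 0 < dt \<longrightarrow> generated_with_CFL lam F F1 F2 u0 dx dt U \<longrightarrow>
           (\<forall>t\<ge>0.
              Linf_norm (\<lambda>x. interpolation dx dt U x t) \<le> Linf_norm u0 \<and>
              L1_norm (\<lambda>x. interpolation dx dt U x t) \<le> L1_norm u0 \<and>
              BV_seminorm (\<lambda>x. interpolation dx dt U x t) \<le> BV_seminorm u0)) \<and>
         (\<exists>c>0. \<forall>dx dt U. 0 < dx \<longrightarrow> 0 < dt \<longrightarrow> generated_with_CFL lam F F1 F2 u0 dx dt U \<longrightarrow>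
           (\<forall>s\<ge>0. \<forall>t\<ge>0.
              L1_norm (\<lambda>x. interpolation dx dt U x s - interpolation dx dt U x t)
                \<le> ennreal (c * (\<bar>s - t\<bar> + dx))))"
proof -
  have disc: "discretization lam F1 F2 dx dt f u0 F U"
    if "0 < dx" "0 < dt" "generated_with_CFL lam F F1 F2 u0 dx dt U" for dx dt U
    using assms that by unfold_locales auto
  define C where "C = (1 + 1 / (F1 + F2)) * discretization.time_speed lam F1 F2 u0"
  show ?thesis
  \<comment> \<open>\<open>C\<close> is 0 for vanishing initial data; the maximum with 1 keeps the
    constant positive.\<close>
  proof (intro conjI exI[of _ "max C 1"] allI impI)
    fix dx dt U and s t :: real
    assume "0 < dx" "0 < dt" "generated_with_CFL lam F F1 F2 u0 dx dt U" and st: "0 \<le> s" "0 \<le> t"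
    then interpret discretization lam F1 F2 dx dt f u0 F U by (intro disc)
    have "L1_norm (\<lambda>x. interpolation dx dt U x s - interpolation dx dt U x t) \<le> ennreal (C * (\<bar>s - t\<bar> + dx))"
      unfolding C_def using st by (rule time_continuity)
    also have "\<dots> \<le> ennreal (max C 1 * (\<bar>s - t\<bar> + dx))"
      using dx by (intro ennreal_leI mult_right_mono) auto
    finally show "L1_norm (\<lambda>x. interpolation dx dt U x s - interpolation dx dt U x t)
      \<le> ennreal (max C 1 * (\<bar>s - t\<bar> + dx))" .
  qed (simp_all add: discretization.Linf_stable[OF disc] discretization.L1_stable[OF disc]
      discretization.BV_stable[OF disc])
qed

end
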